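(* Let $\gamma>0$, let $\mathbf U:\mathbb T^2\to\mathbb R$ be either $(2-\sin(2\pi x_1)-\sin(2\pi x_2))^\gamma$ or $(2-\cos(2\pi x_1)-\cos(2\pi x_2))^\gamma$, let $\xi\in\mathbb R^2$ be non-resonant, $H(x,p)=\frac12|p|^2-\mathbf U(\xi x)$ on $\mathbb R\times\mathbb R$, with effective Hamiltonian $\overline H$ and $p_0=\int_{\mathbb T^2}(2\mathbf U(\mathbf x))^{1/2}d\mathbf x$. Then, with a constant $C$, for $\tilde p,p\ge p_0$ we have $$|\overline H'(\tilde p)-\overline H'(p)|\le C|\tilde p-p|^{\frac12-\frac1\gamma}\quad\text{if }\gamma\in(2,\infty),$$ $$|\overline H'(\tilde p)-\overline H'(p)|\le C\left|\log\left(\overline H(\tilde p)\right)-\log\left(\overline H(p)\right)\right|\quad\text{if }\gamma=2,$$ $$|\overline H'(\tilde p)-\overline H'(p)|\le C|\tilde p-p|^{\frac1\gamma-\frac12}\quad\text{if }\gamma\in(\tfrac23,2),$$ $$|\overline H'(\tilde p)-\overline H'(p)|\le C\left|\overline H(\tilde p)(1+|\log(\overline H(\tilde p))|)-\overline H(p)(1+|\log(\overline H(p))|)\right|\quad\text{if }\gamma=\tfrac23,$$ $$|\overline H'(\tilde p)-\overline H'(p)|\le C|\tilde p-p|\quad\text{if }\gamma\in(0,\tfrac23).$$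
   Context: $\mathbb T^2$ is the flat two-dimensional torus (the quotient of $\mathbb R^2$ by $\mathbb Z^2$); functions on $\mathbb T^2$ are identified with $\mathbb Z^2$-periodic functions, and $\xi x=(\xi_1x,\xi_2x)$ for $x\in\mathbb R$. $\xi$ is non-resonant if $\kappa\cdot\xi\ne0$ for all $\kappa\in\mathbb Z^2\setminus\{0\}$. Effective Hamiltonian: for $p\in\mathbb R$, $\overline H(p)$ is the unique constant such that for every $\delta>0$ there is a viscosity solution $w_\delta$, bounded, uniformly continuous and Lipschitz on $\mathbb R$, of $\overline H(p)-\delta\le H(x,p+Dw_\delta(x))\le\overline H(p)+\delta$ in $\mathbb R$. In this setting $\overline H$ is even, $\overline H=0$ on $[-p_0,p_0]$, for $p\ge p_0$ the value $\overline H(p)\ge0$ is determined by $p=\int_{\mathbb T^2}(2(\overline H(p)+\mathbf U(\mathbf x)))^{1/2}d\mathbf x$, and $\overline H$ is $C^1$ on $\mathbb R\setminus[-p_0,p_0]$. Convention: $\overline H'(p_0)$ denotes the right derivative $\overline H'_+(p_0)=\lim_{p\to p_0^+}\frac{\overline H(p)-\overline H(p_0)}{p-p_0}$.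
   Formalization: For γ>2, γ=2 and 2/3<γ<2, C may depend on an upper bound R for p̃,p (one C fails at infinity, where H̄'(p)~p); γ=2 takes p̃,p>p0 (log 0); for γ=2/3 energies H̄ in (1−η,1) are excluded with C depending on η (the weight has zero left slope at H̄=1). *)

theory Defs
  imports "HOL-Analysis.Analysis"
begin

text \<open>Viscosity inequalities on the real line, \<open>F (x, Dw x) \<le> a\<close> and \<open>a \<le> F (x, Dw x)\<close>, tested
  with continuously differentiable functions \<open>\<phi>\<close> touching \<open>w\<close> from above, respectively below.\<close>

definition C1_with_deriv :: "(real \<Rightarrow> real) \<Rightarrow> (real \<Rightarrow> real) \<Rightarrow> bool" where
  "C1_with_deriv \<phi> \<phi>' \<longleftrightarrow>
     (\<forall>x. (\<phi> has_real_derivative \<phi>' x) (at x)) \<and> continuous_on UNIV \<phi>'"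

definition viscosity_le :: "(real \<Rightarrow> real \<Rightarrow> real) \<Rightarrow> (real \<Rightarrow> real) \<Rightarrow> real \<Rightarrow> bool" where
  "viscosity_le F w a \<longleftrightarrow>
     (\<forall>\<phi> \<phi>' x. C1_with_deriv \<phi> \<phi>' \<longrightarrow>
        (\<forall>\<^sub>F y in nhds x. w y - \<phi> y \<le> w x - \<phi> x) \<longrightarrow> F x (\<phi>' x) \<le> a)"

definition viscosity_ge :: "(real \<Rightarrow> real \<Rightarrow> real) \<Rightarrow> (real \<Rightarrow> real) \<Rightarrow> real \<Rightarrow> bool" where
  "viscosity_ge F w a \<longleftrightarrow>
     (\<forall>\<phi> \<phi>' x. C1_with_deriv \<phi> \<phi>' \<longrightarrow>
        (\<forall>\<^sub>F y in nhds x. w x - \<phi> x \<le> w y - \<phi> y) \<longrightarrow> a \<le> F x (\<phi>' x))"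

definition approx_corrector ::
    "(real \<Rightarrow> real \<Rightarrow> real) \<Rightarrow> real \<Rightarrow> real \<Rightarrow> real \<Rightarrow> (real \<Rightarrow> real) \<Rightarrow> bool" where
  "approx_corrector H p c \<delta> w \<longleftrightarrow>
     bounded (range w) \<and> uniformly_continuous_on UNIV w \<and> (\<exists>L. L-lipschitz_on UNIV w) \<and>
     viscosity_le (\<lambda>x q. H x (p + q)) w (c + \<delta>) \<and>
     viscosity_ge (\<lambda>x q. H x (p + q)) w (c - \<delta>)"

definition effective_hamiltonian :: "(real \<Rightarrow> real \<Rightarrow> real) \<Rightarrow> real \<Rightarrow> real" where
  "effective_hamiltonian H p = (THE c. \<forall>\<delta>>0. \<exists>w. approx_corrector H p c \<delta> w)"

text \<open>Functions on the torus are \<open>\<int>\<^sup>2\<close>-periodic functions on the plane, integrated over a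
  fundamental domain.\<close>

definition torus_integral :: "(real \<times> real \<Rightarrow> real) \<Rightarrow> real" where
  "torus_integral f = integral ({0..1} \<times> {0..1}) f"

definition non_resonant :: "real \<times> real \<Rightarrow> bool" where
  "non_resonant \<xi> \<longleftrightarrow>
     (\<forall>k l :: int. (k, l) \<noteq> (0, 0) \<longrightarrow> (of_int k, of_int l) \<bullet> \<xi> \<noteq> 0)"

definition sin_potential :: "real \<Rightarrow> real \<times> real \<Rightarrow> real" where
  "sin_potential \<gamma> = (\<lambda>(x1, x2). (2 - sin (2 * pi * x1) - sin (2 * pi * x2)) powr \<gamma>)"

definition cos_potential :: "real \<Rightarrow> real \<times> real \<Rightarrow> real" where
  "cos_potential \<gamma> = (\<lambda>(x1, x2). (2 - cos (2 * pi * x1) - cos (2 * pi * x2)) powr \<gamma>)"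

text \<open>The derivative of \<open>f\<close> on \<open>[a, \<infinity>)\<close>, where at the endpoint \<open>a\<close> the right derivative is meant.\<close>

definition deriv_from :: "real \<Rightarrow> (real \<Rightarrow> real) \<Rightarrow> real \<Rightarrow> real" where
  "deriv_from a f p =
     (if p = a then Lim (at_right a) (\<lambda>q. (f q - f a) / (q - a)) else deriv f p)"

end

theory Submission
  imports Defs
begin

text \<open>Let \<open>G h\<close> be the torus mean of \<open>sqrt (2 (h + U))\<close>. By Stone--Weierstrass in the variable
  \<open>t = U powr (1/\<gamma>)\<close>, the integrand is uniformly close to trigonometric polynomials with the same
  mean. Along a non-resonant line these differ from their mean by the derivative of a bounded function,
  so \<open>p = G h\<close> has smooth approximate correctors at level \<open>h\<close>. Comparing any other approximate
  corrector with a smooth one shows that the level is unique; hence the effective Hamiltonian is the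
  inverse of \<open>G\<close> on \<open>[p0, \<infinity>)\<close> and its derivative is \<open>1 / g\<close> with \<open>g = G'\<close>.

  The derivative of \<open>1 / g\<close> in \<open>h\<close> is \<open>I / g\<^sup>2\<close>, where \<open>I\<close> is the mean of \<open>(2 (h + U)) powr (-3/2)\<close>.
  Near its zero \<open>U\<close> behaves like \<open>r powr (2 \<gamma>)\<close>, and rescaling \<open>r\<close> by \<open>h powr (1 / (2 \<gamma>))\<close> gives the size
  of \<open>I\<close>: \<open>h powr (1/\<gamma> - 3/2)\<close>, logarithmic or bounded according to the sign of \<open>\<gamma> - 2/3\<close>. For
  \<open>\<gamma> > 2\<close> one also needs that \<open>g\<close> blows up at least like \<open>h powr (1/\<gamma> - 1/2)\<close>. Integrating these bounds
  on \<open>I / g\<^sup>2\<close> gives all the estimates on \<open>(p0, \<infinity>)\<close>, and they extend to \<open>p0\<close> because \<open>1 / g\<close> is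
  monotone, so that the right derivative at \<open>p0\<close> is its limit.\<close>

section \<open>Trigonometric polynomials and smooth correctors\<close>

lemma unit_square: "{0..1} \<times> {0..1} = cbox (0 :: real, 0 :: real) (1, 1)"
  by (simp add: cbox_Pair_eq)

lemma integrable_on_torus:
  fixes f :: "real \<times> real \<Rightarrow> real"
  assumes "continuous_on UNIV f"
  shows "f integrable_on ({0..1} \<times> {0..1})"
  unfolding unit_square by (rule integrable_continuous) (rule continuous_on_subset[OF assms], simp)

lemma torus_integral_iterated:
  assumes "continuous_on UNIV f"
  shows "torus_integral f = integral {0..1} (\<lambda>x. integral {0..1} (\<lambda>y. f (x, y)))"
  using integral_prod_continuous[OF continuous_on_subset[OF assms], of 0 0 1 1]
  by (simp add: torus_integral_def unit_square)

lemma torus_integral_add: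
  assumes "continuous_on UNIV f" "continuous_on UNIV g"
  shows "torus_integral (\<lambda>x. f x + g x) = torus_integral f + torus_integral g"
  unfolding torus_integral_def
  by (rule integral_add) (simp_all add: integrable_on_torus assms)

lemma torus_integral_const: "torus_integral (\<lambda>x. c) = c"
  unfolding torus_integral_def unit_square by (simp add: content_cbox_pair_eq0_D content_Pair)

lemma torus_integral_mono:
  assumes "continuous_on UNIV f" "continuous_on UNIV g" "\<And>x. f x \<le> g x"
  shows "torus_integral f \<le> torus_integral g"
  unfolding torus_integral_def
  by (rule integral_le) (simp_all add: integrable_on_torus assms)

lemma torus_integral_diff:
  assumes "continuous_on UNIV f" "continuous_on UNIV g"
  shows "torus_integral (\<lambda>x. f x - g x) = torus_integral f - torus_integral g"
  unfolding torus_integral_def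
  by (rule integral_diff) (simp_all add: integrable_on_torus assms)

section \<open>Trigonometric polynomials and their primitives along a line\<close>

text \<open>Waves carry a free phase, so sines are included and products of waves are again sums of
  waves; frequency zero gives the constants.\<close>

inductive trig_poly :: "(real \<times> real \<Rightarrow> real) \<Rightarrow> bool" where
  wave: "trig_poly (\<lambda>x. a * cos (2 * pi * (of_int k * fst x + of_int l * snd x) + \<theta>))"
| add: "trig_poly f \<Longrightarrow> trig_poly g \<Longrightarrow> trig_poly (\<lambda>x. f x + g x)"

lemma trig_poly_const: "trig_poly (\<lambda>x. c)"
  using wave[of c 0 0 0] by simp

lemma trig_poly_continuous: "trig_poly f \<Longrightarrow> continuous_on UNIV f"
  by (induction rule: trig_poly.induct) (intro continuous_intros; assumption)+

lemma trig_poly_bounded: "trig_poly f \<Longrightarrow> \<exists>B. \<forall>x. \<bar>f x\<bar> \<le> B"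
proof (induction rule: trig_poly.induct)
  case (wave a k l \<theta>)
  show ?case by (intro exI[of _ "\<bar>a\<bar>"]) (simp add: abs_mult mult_left_le)
next
  case (add f g)
  then obtain B C where "\<forall>x. \<bar>f x\<bar> \<le> B" "\<forall>x. \<bar>g x\<bar> \<le> C" by blast
  then have "\<forall>x. \<bar>f x + g x\<bar> \<le> B + C" by (meson abs_triangle_ineq add_mono order_trans)
  then show ?case by blast
qed

text \<open>Product-to-sum formula. The left factor is a single wave, so that closure under products
  follows by two nested inductions.\<close>

lemma trig_poly_wave_mult:
  assumes "trig_poly g"
  shows "trig_poly (\<lambda>x. a * cos (2 * pi * (of_int k * fst x + of_int l * snd x) + \<theta>) * g x)"
  using assms
proof (induction rule: trig_poly.induct)
  case (wave b m n \<phi>)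
  have "trig_poly (\<lambda>x. a * b / 2 * cos (2 * pi * (of_int (k - m) * fst x + of_int (l - n) * snd x) + (\<theta> - \<phi>))
     + a * b / 2 * cos (2 * pi * (of_int (k + m) * fst x + of_int (l + n) * snd x) + (\<theta> + \<phi>)))"
    by (intro trig_poly.intros)
  also have "(\<lambda>x. a * b / 2 * cos (2 * pi * (of_int (k - m) * fst x + of_int (l - n) * snd x) + (\<theta> - \<phi>))
     + a * b / 2 * cos (2 * pi * (of_int (k + m) * fst x + of_int (l + n) * snd x) + (\<theta> + \<phi>)))
     = (\<lambda>x. a * cos (2 * pi * (of_int k * fst x + of_int l * snd x) + \<theta>) *
          (b * cos (2 * pi * (of_int m * fst x + of_int n * snd x) + \<phi>)))" (is "?l = ?r")
  proof
    fix x :: "real \<times> real"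
    let ?A = "2 * pi * (of_int k * fst x + of_int l * snd x) + \<theta>"
    let ?B = "2 * pi * (of_int m * fst x + of_int n * snd x) + \<phi>"
    have "2 * pi * (of_int (k - m) * fst x + of_int (l - n) * snd x) + (\<theta> - \<phi>) = ?A - ?B"
      "2 * pi * (of_int (k + m) * fst x + of_int (l + n) * snd x) + (\<theta> + \<phi>) = ?A + ?B"
      by (simp_all add: algebra_simps)
    then have "?l x = a * b / 2 * cos (?A - ?B) + a * b / 2 * cos (?A + ?B)" by (simp only:)
    also have "\<dots> = a * cos ?A * (b * cos ?B)"
      unfolding cos_diff cos_add by (simp add: algebra_simps)
    finally show "?l x = ?r x" .
  qed
  finally show ?case .
next
  case (add f g)
  then show ?case using trig_poly.add by (fastforce simp: distrib_left)
qed

lemma trig_poly_mult: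
  assumes "trig_poly f" "trig_poly g"
  shows "trig_poly (\<lambda>x. f x * g x)"
  using assms
proof (induction rule: trig_poly.induct)
  case (wave a k l \<theta>)
  then show ?case by (rule trig_poly_wave_mult)
next
  case (add f1 f2)
  then show ?case using trig_poly.add by (fastforce simp: distrib_right)
qed

lemma integral_cos_period:
  assumes "k \<noteq> 0"
  shows "integral {0..1} (\<lambda>y. cos (c + 2 * pi * of_int k * y)) = 0"
proof -
  let ?F = "\<lambda>y. sin (c + 2 * pi * of_int k * y) / (2 * pi * of_int k)"
  have "((\<lambda>y. cos (c + 2 * pi * of_int k * y)) has_integral (?F 1 - ?F 0)) {0..1}"
    using assms
    by (intro fundamental_theorem_of_calculus)
      (auto simp flip: has_real_derivative_iff_has_vector_derivative intro!: derivative_eq_intros)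
  moreover have "sin (c + 2 * pi * of_int k) = sin c"
    by (simp add: sin_add sin_int_2pin cos_int_2pin)
  ultimately show ?thesis by (simp add: integral_unique)
qed

lemma torus_integral_wave:
  assumes "(k, l) \<noteq> (0, 0)"
  shows "torus_integral (\<lambda>x. a * cos (2 * pi * (of_int k * fst x + of_int l * snd x) + \<theta>)) = 0"
proof -
  have iter: "torus_integral (\<lambda>x. a * cos (2 * pi * (of_int k * fst x + of_int l * snd x) + \<theta>))
    = a * integral {0..1} (\<lambda>x. integral {0..1} (\<lambda>y. cos (2 * pi * (of_int k * x + of_int l * y) + \<theta>)))"
    by (subst torus_integral_iterated) (auto intro!: continuous_intros)
  show ?thesis
  proof (cases "l = 0")
    case True
    then have "k \<noteq> 0" using assms by simp
    from integral_cos_period[OF this, of \<theta>] show ?thesis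
      unfolding iter using True by (simp add: algebra_simps)
  next
    case False
    have "integral {0..1} (\<lambda>y. cos (2 * pi * (of_int k * x + of_int l * y) + \<theta>)) = 0" for x
      using integral_cos_period[OF False, of "\<theta> + 2 * pi * of_int k * x"] by (simp add: algebra_simps)
    then show ?thesis unfolding iter by simp
  qed
qed

text \<open>Non-resonance makes the frequency \<open>\<omega>\<close> of each nonconstant wave along
  the line nonzero, so the wave has a bounded primitive. Subtracting the mean removes the constant
  waves, and finite sums of bounded primitives stay bounded.\<close>

lemma trig_poly_antiderivative:
  assumes "non_resonant \<xi>" "trig_poly f"
  shows "\<exists>W B. (\<forall>x. \<bar>W x\<bar> \<le> B) \<and>
    (\<forall>x. (W has_real_derivative f (x *\<^sub>R \<xi>) - torus_integral f) (at x))"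
  using assms(2)
proof (induction rule: trig_poly.induct)
  case (wave a k l \<theta>)
  obtain \<xi>1 \<xi>2 where \<xi>: "\<xi> = (\<xi>1, \<xi>2)" by (cases \<xi>)
  show ?case
  proof (cases "(k, l) = (0, 0)")
    case True
    then show ?thesis
      by (intro exI[of _ "\<lambda>_. 0"] exI[of _ 0]) (simp add: torus_integral_const)
  next
    case False
    define \<omega> where "\<omega> = 2 * pi * (of_int k * \<xi>1 + of_int l * \<xi>2)"
    have \<omega>: "\<omega> \<noteq> 0" using assms(1) False unfolding non_resonant_def \<omega>_def \<xi>
      by (auto simp: inner_prod_def)
    have arg: "2 * pi * (of_int k * fst (x *\<^sub>R \<xi>) + of_int l * snd (x *\<^sub>R \<xi>)) = \<omega> * x" for x
      by (simp add: \<xi> \<omega>_def algebra_simps)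
    let ?W = "\<lambda>x. a / \<omega> * sin (\<omega> * x + \<theta>)"
    have "\<forall>x. \<bar>?W x\<bar> \<le> \<bar>a / \<omega>\<bar>"
      unfolding abs_mult by (intro allI mult_left_le) auto
    moreover have "\<forall>x. (?W has_real_derivative a * cos (\<omega> * x + \<theta>)) (at x)"
      using \<omega> by (auto intro!: derivative_eq_intros)
    ultimately show ?thesis unfolding torus_integral_wave[OF False] arg diff_0_right by (intro exI[of _ ?W] exI[of _ "\<bar>a / \<omega>\<bar>"] conjI)
  qed
next
  case (add f g)
  then obtain V A W B where V: "\<forall>x. \<bar>V x\<bar> \<le> A" "\<forall>x. \<bar>W x\<bar> \<le> B"
    "\<forall>x. (V has_real_derivative f (x *\<^sub>R \<xi>) - torus_integral f) (at x)"
    "\<forall>x. (W has_real_derivative g (x *\<^sub>R \<xi>) - torus_integral g) (at x)" by blast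
  have "\<forall>x. \<bar>V x + W x\<bar> \<le> A + B" using V(1,2) by (meson abs_triangle_ineq add_mono order_trans)
  moreover have "((\<lambda>x. V x + W x) has_real_derivative f (x *\<^sub>R \<xi>) + g (x *\<^sub>R \<xi>)
      - torus_integral (\<lambda>x. f x + g x)) (at x)" for x
    unfolding torus_integral_add[OF add(1,2)[THEN trig_poly_continuous]]
    using DERIV_add[OF V(3,4)[rule_format]] by (simp add: algebra_simps)
  ultimately show ?case by (intro exI[of _ "\<lambda>x. V x + W x"] exI[of _ "A + B"] conjI allI) auto
qed

section \<open>The well variable and approximation with exact mean\<close>

text \<open>The phase unifies both potentials: raised to the power \<gamma>, phase \<open>0\<close>
  gives the cosine one and phase \<open>- (pi / 2)\<close> the sine one.\<close>

definition well :: "real \<Rightarrow> real \<times> real \<Rightarrow> real" where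
  "well \<theta> x = 2 - cos (2 * pi * fst x + \<theta>) - cos (2 * pi * snd x + \<theta>)"

lemma well_range: "0 \<le> well \<theta> x" "well \<theta> x \<le> 4"
proof -
  have "\<bar>cos (2 * pi * fst x + \<theta>)\<bar> \<le> 1" "\<bar>cos (2 * pi * snd x + \<theta>)\<bar> \<le> 1" by simp_all
  then show "0 \<le> well \<theta> x" "well \<theta> x \<le> 4" unfolding well_def by linarith+
qed

lemma continuous_on_well [continuous_intros]: "continuous_on S (well \<theta>)"
  unfolding well_def by (intro continuous_intros)

lemma continuous_on_comp_well:
  assumes "continuous_on {0..4} f"
  shows "continuous_on S (\<lambda>x. f (well \<theta> x))"
  by (rule continuous_on_compose2[OF assms continuous_on_well]) (auto simp: well_range)

lemma trig_poly_well: "trig_poly (well \<theta>)"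
proof -
  have "trig_poly (\<lambda>x. 2 + ((-1) * cos (2 * pi * (of_int 1 * fst x + of_int 0 * snd x) + \<theta>)
    + (-1) * cos (2 * pi * (of_int 0 * fst x + of_int 1 * snd x) + \<theta>)))"
    by (intro trig_poly.intros trig_poly_const)
  also have "(\<lambda>x. 2 + ((-1) * cos (2 * pi * (of_int 1 * fst x + of_int 0 * snd x) + \<theta>)
    + (-1) * cos (2 * pi * (of_int 0 * fst x + of_int 1 * snd x) + \<theta>))) = well \<theta>"
    by (simp add: well_def fun_eq_iff)
  finally show ?thesis .
qed

text \<open>Trigonometric polynomials form an algebra containing \<open>well\<close>, so Weierstrass
  approximation in the variable \<open>well\<close> stays inside it.\<close>

lemma trig_poly_comp_well:
  assumes "real_polynomial_function q"
  shows "trig_poly (\<lambda>x. q (well \<theta> x))"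
  using assms
proof (induction rule: real_polynomial_function.induct)
  case (linear f)
  have "f y = f 1 * y" for y :: real
    using linear_cmul[OF bounded_linear.linear[OF linear], of y 1] by simp
  then have "(\<lambda>x. f (well \<theta> x)) = (\<lambda>x. f 1 * well \<theta> x)" by blast
  then show ?case
    using trig_poly_mult[OF trig_poly_const[of "f 1"] trig_poly_well[of \<theta>]] by simp
qed (simp_all add: trig_poly_const trig_poly.add trig_poly_mult)

text \<open>Polynomial approximation is taken within \<open>\<epsilon> / 2\<close>; a constant then
  corrects the mean at a further cost of at most \<open>\<epsilon> / 2\<close>. The mean must be
  exact because any remaining drift would make the corrector unbounded.\<close>

lemma trig_poly_approx:
  assumes "continuous_on {0..4} f" "\<epsilon> > 0"
  obtains P where "trig_poly P" "\<And>x. \<bar>P x - f (well \<theta> x)\<bar> \<le> \<epsilon>"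
    "torus_integral P = torus_integral (\<lambda>x. f (well \<theta> x))"
proof -
  obtain q where q: "real_polynomial_function q" "\<And>t. t \<in> {0..4} \<Longrightarrow> \<bar>f t - q t\<bar> < \<epsilon> / 2"
    using Stone_Weierstrass_real_polynomial_function[of "{0..4}" f "\<epsilon> / 2"] assms by auto
  define Q where "Q = (\<lambda>x. q (well \<theta> x))"
  let ?F = "\<lambda>x. f (well \<theta> x)"
  have Q: "trig_poly Q" unfolding Q_def by (rule trig_poly_comp_well[OF q(1)])
  note cont = trig_poly_continuous[OF Q] continuous_on_comp_well[OF assms(1), of UNIV \<theta>]
  have near: "\<bar>?F x - Q x\<bar> \<le> \<epsilon> / 2" "?F x - Q x \<le> \<epsilon> / 2" "- (\<epsilon> / 2) \<le> ?F x - Q x" for x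
  proof -
    have "\<bar>?F x - Q x\<bar> < \<epsilon> / 2"
      unfolding Q_def by (rule q(2)) (simp add: well_range)
    then show "\<bar>?F x - Q x\<bar> \<le> \<epsilon> / 2" "?F x - Q x \<le> \<epsilon> / 2" "- (\<epsilon> / 2) \<le> ?F x - Q x"
      by linarith+
  qed
  have "torus_integral (\<lambda>x. ?F x - Q x) \<le> torus_integral (\<lambda>_. \<epsilon> / 2)"
    "torus_integral (\<lambda>_. - (\<epsilon> / 2)) \<le> torus_integral (\<lambda>x. ?F x - Q x)"
    by (intro torus_integral_mono continuous_intros cont near)+
  then have mean: "\<bar>torus_integral ?F - torus_integral Q\<bar> \<le> \<epsilon> / 2"
    unfolding torus_integral_const torus_integral_diff[OF cont(2,1)] by linarith
  show thesis
  proof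
    show "trig_poly (\<lambda>x. Q x + (torus_integral ?F - torus_integral Q))"
      by (intro trig_poly.add Q trig_poly_const)
    show "torus_integral (\<lambda>x. Q x + (torus_integral ?F - torus_integral Q)) = torus_integral ?F"
      by (subst torus_integral_add) (auto simp: torus_integral_const cont)
    show "\<bar>Q x + (torus_integral ?F - torus_integral Q) - ?F x\<bar> \<le> \<epsilon>" for x
      using near(1)[of x] mean by linarith
  qed
qed

text \<open>The penalty \<open>\<epsilon> sqrt (1 + x\<^sup>2)\<close> forces a maximum although the line is not compact, and perturbs
  slopes by at most \<open>\<epsilon>\<close>.\<close>

lemma touching_point:
  assumes "continuous_on UNIV u" "\<And>x. \<bar>u x\<bar> \<le> B" "\<epsilon> > 0"
  obtains x :: real where "\<And>y. u y - \<epsilon> * sqrt (1 + y\<^sup>2) \<le> u x - \<epsilon> * sqrt (1 + x\<^sup>2)"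
proof -
  let ?f = "\<lambda>y. u y - \<epsilon> * sqrt (1 + y\<^sup>2)"
  \<comment> \<open>Beyond \<open>R\<close> the penalty is at least
    \<open>2 * B + \<epsilon>\<close>, which pushes the penalized value down to
    \<open>- B - \<epsilon>\<close> or lower, no more than its value at \<open>0\<close>.\<close>
  define R where "R = (2 * B + \<epsilon>) / \<epsilon>"
  have "B \<ge> 0" using assms(2)[of 0] by linarith
  then have R: "R \<ge> 0" using assms(3) by (simp add: R_def)
  have c: "continuous_on {-R..R} ?f"
    by (intro continuous_intros continuous_on_subset[OF assms(1)]) auto
  obtain x where x: "x \<in> {-R..R}" "\<And>y. y \<in> {-R..R} \<Longrightarrow> ?f y \<le> ?f x"
    using continuous_attains_sup[OF _ _ c] R by auto
  have "?f y \<le> ?f x" for y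
  proof (cases "y \<in> {-R..R}")
    case False
    then have "R \<le> \<bar>y\<bar>" by auto
    also have "\<bar>y\<bar> \<le> sqrt (1 + y\<^sup>2)" by (rule real_le_rsqrt) simp
    finally have "\<epsilon> * R \<le> \<epsilon> * sqrt (1 + y\<^sup>2)" using assms(3) by simp
    then have "2 * B + \<epsilon> \<le> \<epsilon> * sqrt (1 + y\<^sup>2)" using assms(3) by (simp add: R_def)
    then have "?f y \<le> ?f 0" using assms(2)[of y] assms(2)[of 0] by simp
    also have "\<dots> \<le> ?f x" using R by (intro x(2)) auto
    finally show ?thesis .
  qed (use x in auto)
  then show thesis by (rule that)
qed

lemma sqrt_one_plus_square_deriv:
  "((\<lambda>x. sqrt (1 + x\<^sup>2)) has_real_derivative x / sqrt (1 + x\<^sup>2)) (at x)"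
proof -
  have "1 + x\<^sup>2 > 0" by (simp add: add_pos_nonneg)
  then show ?thesis by (auto intro!: derivative_eq_intros simp: field_simps)
qed

lemma sqrt_one_plus_square_slope: "\<bar>x / sqrt (1 + x\<^sup>2)\<bar> \<le> 1"
proof -
  have "\<bar>x\<bar> \<le> sqrt (1 + x\<^sup>2)" by (rule real_le_rsqrt) simp
  moreover have "1 + x\<^sup>2 > 0" by (simp add: add_pos_nonneg)
  ultimately show ?thesis by (simp add: abs_divide)
qed

text \<open>Supplies the test functions for the comparison: a smooth corrector plus or minus the
  penalty.\<close>

lemma C1_with_deriv_perturbed:
  assumes "\<And>x. (W has_real_derivative W' x) (at x)" "continuous_on UNIV W'"
  shows "C1_with_deriv (\<lambda>x. W x + c * sqrt (1 + x\<^sup>2)) (\<lambda>x. W' x + c * (x / sqrt (1 + x\<^sup>2)))"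
  unfolding C1_with_deriv_def
proof (intro conjI allI)
  show "((\<lambda>x. W x + c * sqrt (1 + x\<^sup>2)) has_real_derivative W' x + c * (x / sqrt (1 + x\<^sup>2))) (at x)" for x
    by (intro DERIV_add assms(1) DERIV_cmult sqrt_one_plus_square_deriv)
  have "sqrt (1 + x\<^sup>2) \<noteq> 0" for x :: real by (simp add: add_nonneg_eq_0_iff)
  then show "continuous_on UNIV (\<lambda>x. W' x + c * (x / sqrt (1 + x\<^sup>2)))"
    by (intro continuous_intros assms(2)) auto
qed

text \<open>The change of kinetic energy factors as \<open>s * (a + s / 2)\<close>, so for bounded
  slopes it is of the order of the perturbation.\<close>

lemma square_half_perturb:
  fixes a s M \<epsilon> :: real
  assumes "\<bar>a\<bar> \<le> M" "\<bar>s\<bar> \<le> \<epsilon>" "\<epsilon> \<le> 1"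
  shows "\<bar>1/2 * (a + s)\<^sup>2 - 1/2 * a\<^sup>2\<bar> \<le> \<epsilon> * (M + 1)"
proof -
  have "1/2 * (a + s)\<^sup>2 - 1/2 * a\<^sup>2 = s * (a + s / 2)" by (simp add: power2_eq_square algebra_simps)
  also have "\<bar>\<dots>\<bar> = \<bar>s\<bar> * \<bar>a + s/2\<bar>" by (rule abs_mult)
  also have "\<dots> \<le> \<epsilon> * (M + 1)" using assms by (intro mult_mono) linarith+
  finally show ?thesis .
qed

lemma bounded_range_realE:
  fixes f :: "'a \<Rightarrow> real"
  assumes "bounded (range f)"
  obtains B where "\<And>x. \<bar>f x\<bar> \<le> B"
  using assms by (auto simp: bounded_iff)

lemma viscosity_leD:
  assumes "viscosity_le F w a" "C1_with_deriv \<phi> \<phi>'" "\<forall>\<^sub>F y in nhds x. w y - \<phi> y \<le> w x - \<phi> x"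
  shows "F x (\<phi>' x) \<le> a"
  using assms unfolding viscosity_le_def by blast

lemma viscosity_geD:
  assumes "viscosity_ge F w a" "C1_with_deriv \<phi> \<phi>'" "\<forall>\<^sub>F y in nhds x. w x - \<phi> x \<le> w y - \<phi> y"
  shows "a \<le> F x (\<phi>' x)"
  using assms unfolding viscosity_ge_def by blast

lemma small_factor:
  fixes \<delta> M :: real
  assumes "\<delta> > 0" "M \<ge> 0"
  obtains \<epsilon> where "\<epsilon> > 0" "\<epsilon> \<le> 1" "\<epsilon> * (M + 1) \<le> \<delta>"
proof
  have "min 1 (\<delta> / (M + 1)) \<le> \<delta> / (M + 1)" by simp
  then show "min 1 (\<delta> / (M + 1)) * (M + 1) \<le> \<delta>"
    using assms(2) by (subst (asm) pos_le_divide_eq) auto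
qed (use assms in auto)

section \<open>Smooth correctors and uniqueness of the level\<close>

text \<open>A classical counterpart of \<open>approx_corrector\<close>: \<open>V\<close> is the
  potential along the line, and the bound on \<open>W'\<close> stands in for the Lipschitz
  condition.\<close>

definition smooth_corrector :: "(real \<Rightarrow> real) \<Rightarrow> real \<Rightarrow> real \<Rightarrow> real \<Rightarrow> (real \<Rightarrow> real) \<Rightarrow> (real \<Rightarrow> real) \<Rightarrow> bool" where
  "smooth_corrector V p c \<delta> W W' \<longleftrightarrow> bounded (range W) \<and> bounded (range W') \<and> continuous_on UNIV W' \<and>
     (\<forall>x. (W has_real_derivative W' x) (at x)) \<and> (\<forall>x. \<bar>1/2 * (p + W' x)\<^sup>2 - V x - c\<bar> \<le> \<delta>)"

lemma local_max_deriv_eq: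
  assumes "\<forall>\<^sub>F y in nhds x. w y - \<phi> y \<le> w x - \<phi> x"
    "(w has_real_derivative d) (at x)" "(\<phi> has_real_derivative e) (at x)"
  shows "d = (e :: real)"
proof -
  obtain r where r: "r > 0" "\<And>y. dist y x < r \<Longrightarrow> w y - \<phi> y \<le> w x - \<phi> x"
    using assms(1) unfolding eventually_nhds_metric by blast
  have "d - e = 0"
    by (rule DERIV_local_max[OF DERIV_diff[OF assms(2,3)] r(1)]) (use r(2) in \<open>auto simp: dist_real_def\<close>)
  then show ?thesis by simp
qed

text \<open>A test function touching a differentiable function has the same slope at the contact
  point, so both viscosity inequalities reduce to the pointwise one.\<close>

lemma smooth_corrector_approx:
  assumes "smooth_corrector V p c \<delta> W W'"
  shows "approx_corrector (\<lambda>x q. 1/2 * \<bar>q\<bar>\<^sup>2 - V x) p c \<delta> W"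
proof -
  note a = assms[unfolded smooth_corrector_def]
  have dW: "(W has_real_derivative W' x) (at x)" and eq: "\<bar>1/2 * (p + W' x)\<^sup>2 - V x - c\<bar> \<le> \<delta>" for x
    using a by blast+
  obtain L where L: "\<And>x. \<bar>W' x\<bar> \<le> L" using a by (auto simp: bounded_iff)
  have "L-lipschitz_on UNIV W"
  proof (rule lipschitz_onI)
    show "0 \<le> L" using L[of 0] by linarith
    show "dist (W x) (W y) \<le> L * dist x y" for x y
      using field_differentiable_bound[of UNIV W W' L x y] dW L by (simp add: dist_norm)
  qed
  moreover have "viscosity_le (\<lambda>x q. 1/2 * \<bar>p + q\<bar>\<^sup>2 - V x) W (c + \<delta>)"
    unfolding viscosity_le_def
  proof (intro allI impI)
    fix \<phi> \<phi>' x assume h: "C1_with_deriv \<phi> \<phi>'" "\<forall>\<^sub>F y in nhds x. W y - \<phi> y \<le> W x - \<phi> x"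
    have eq': "W' x = \<phi>' x"
      using h(1) unfolding C1_with_deriv_def by (intro local_max_deriv_eq[OF h(2) dW]) blast
    show "1/2 * \<bar>p + \<phi>' x\<bar>\<^sup>2 - V x \<le> c + \<delta>"
      using eq[of x] unfolding power2_abs eq' by linarith
  qed
  moreover have "viscosity_ge (\<lambda>x q. 1/2 * \<bar>p + q\<bar>\<^sup>2 - V x) W (c - \<delta>)"
    unfolding viscosity_ge_def
  proof (intro allI impI)
    fix \<phi> \<phi>' x assume h: "C1_with_deriv \<phi> \<phi>'" "\<forall>\<^sub>F y in nhds x. W x - \<phi> x \<le> W y - \<phi> y"
    have ev: "\<forall>\<^sub>F y in nhds x. \<phi> y - W y \<le> \<phi> x - W x" using h(2) by eventually_elim simp
    have eq': "\<phi>' x = W' x"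
      using h(1) unfolding C1_with_deriv_def by (intro local_max_deriv_eq[OF ev _ dW]) blast
    show "c - \<delta> \<le> 1/2 * \<bar>p + \<phi>' x\<bar>\<^sup>2 - V x"
      using eq[of x] unfolding power2_abs eq' by linarith
  qed
  ultimately show ?thesis
    using a by (auto simp: approx_corrector_def intro: lipschitz_on_uniformly_continuous)
qed

text \<open>For uniqueness, a penalized smooth corrector at level \<open>c\<close> serves as test
  function for any corrector \<open>w\<close> at level \<open>d\<close>: the subsolution property of
  \<open>w\<close> excludes \<open>d < c\<close>, the supersolution property excludes
  \<open>d > c\<close>.\<close>

lemma effective_hamiltonian_eqI:
  assumes "\<And>\<delta>. \<delta> > 0 \<Longrightarrow> \<exists>W W'. smooth_corrector V p c \<delta> W W'"
  shows "effective_hamiltonian (\<lambda>x q. 1/2 * \<bar>q\<bar>\<^sup>2 - V x) p = c"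
  unfolding effective_hamiltonian_def
proof (rule the_equality)
  let ?H = "\<lambda>x q. 1/2 * \<bar>q\<bar>\<^sup>2 - V x"
  show "\<forall>\<delta>>0. \<exists>w. approx_corrector ?H p c \<delta> w"
    using assms smooth_corrector_approx by blast
  fix d assume d: "\<forall>\<delta>>0. \<exists>w. approx_corrector ?H p d \<delta> w"
  show "d = c"
  proof (rule ccontr)
    assume "d \<noteq> c"
    \<comment> \<open>A quarter of the gap: the smooth corrector, the penalty and \<open>w\<close>
      contribute an error \<open>\<delta>\<close> each, and \<open>3 * \<delta>\<close> cannot
      bridge \<open>4 * \<delta>\<close>.\<close>
    define \<delta> where "\<delta> = \<bar>d - c\<bar> / 4"
    have \<delta>: "\<delta> > 0" using \<open>d \<noteq> c\<close> by (simp add: \<delta>_def)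
    obtain W W' where W: "smooth_corrector V p c \<delta> W W'" using assms[OF \<delta>] by blast
    note a = W[unfolded smooth_corrector_def]
    obtain w where w: "approx_corrector ?H p d \<delta> w" using d \<delta> by blast
    note b = w[unfolded approx_corrector_def]
    have dW: "(W has_real_derivative W' x) (at x)" and eq: "\<bar>1/2 * (p + W' x)\<^sup>2 - V x - c\<bar> \<le> \<delta>" for x
      using a by blast+
    have contW': "continuous_on UNIV W'" and bounds: "bounded (range W)" "bounded (range W')"
      using a by blast+
    have sub: "viscosity_le (\<lambda>x q. ?H x (p + q)) w (d + \<delta>)"
      and super: "viscosity_ge (\<lambda>x q. ?H x (p + q)) w (d - \<delta>)"
      and boundw: "bounded (range w)" and contw: "continuous_on UNIV w"
      using b uniformly_continuous_imp_continuous by blast+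
    note touch = C1_with_deriv_perturbed[OF dW contW']
    obtain M where M: "\<And>x. \<bar>p + W' x\<bar> \<le> M"
    proof -
      obtain L where L: "\<And>x. \<bar>W' x\<bar> \<le> L" by (rule bounded_range_realE[OF bounds(2)]) blast
      have "\<bar>p + W' x\<bar> \<le> \<bar>p\<bar> + L" for x using L[of x] by linarith
      then show thesis by (rule that)
    qed
    obtain B where B: "\<And>x. \<bar>w x - W x\<bar> \<le> B"
    proof -
      obtain A where A: "\<And>x. \<bar>w x\<bar> \<le> A" by (rule bounded_range_realE[OF boundw]) blast
      obtain B where B: "\<And>x. \<bar>W x\<bar> \<le> B" by (rule bounded_range_realE[OF bounds(1)]) blast
      have "\<bar>w x - W x\<bar> \<le> A + B" for x using A[of x] B[of x] by linarith
      then show thesis by (rule that)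
    qed
    have M0: "M \<ge> 0" using M[of 0] by linarith
    obtain \<epsilon> where \<epsilon>: "\<epsilon> > 0" "\<epsilon> \<le> 1" "\<epsilon> * (M + 1) \<le> \<delta>"
      by (rule small_factor[OF \<delta> M0])
    have contW: "continuous_on UNIV W"
      by (rule DERIV_continuous_on[OF has_field_derivative_at_within[OF dW]])
    \<comment> \<open>Both signs of \<open>s\<close> occur: the penalty is added where
      \<open>w\<close> is touched from above and subtracted where it is touched from below.\<close>
    have perturb: "\<bar>1/2 * \<bar>p + (W' x + s * (x / sqrt (1 + x\<^sup>2)))\<bar>\<^sup>2 - V x - c\<bar> \<le> 2 * \<delta>"
      if "\<bar>s\<bar> = \<epsilon>" for x s
    proof -
      have "\<bar>s * (x / sqrt (1 + x\<^sup>2))\<bar> \<le> \<epsilon>"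
        unfolding abs_mult that using sqrt_one_plus_square_slope[of x] \<epsilon>(1)
        by (intro mult_left_le) auto
      from square_half_perturb[OF M this \<epsilon>(2), of x]
      have "\<bar>1/2 * (p + W' x + s * (x / sqrt (1 + x\<^sup>2)))\<^sup>2 - 1/2 * (p + W' x)\<^sup>2\<bar> \<le> \<delta>"
        using \<epsilon>(3) by linarith
      with eq[of x] show ?thesis unfolding power2_abs add.assoc by linarith
    qed
    show False
    proof (cases "d < c")
      case True
      then have "4 * \<delta> = c - d" by (simp add: \<delta>_def)
      obtain x where x: "\<And>y. w y - W y - \<epsilon> * sqrt (1 + y\<^sup>2) \<le> w x - W x - \<epsilon> * sqrt (1 + x\<^sup>2)"
        by (rule touching_point[OF continuous_on_diff[OF contw contW] B \<epsilon>(1)]) blast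
      have "\<forall>\<^sub>F y in nhds x. w y - (W y + \<epsilon> * sqrt (1 + y\<^sup>2)) \<le> w x - (W x + \<epsilon> * sqrt (1 + x\<^sup>2))"
        using x by (intro always_eventually allI) (simp add: diff_diff_eq)
      from viscosity_leD[OF sub touch[of \<epsilon>] this] have "1/2 * \<bar>p + (W' x + \<epsilon> * (x / sqrt (1 + x\<^sup>2)))\<bar>\<^sup>2 - V x \<le> d + \<delta>" .
      moreover have False if "\<bar>q - c\<bar> \<le> 2 * \<delta>" "q \<le> d + \<delta>" for q
        using that \<delta> \<open>4 * \<delta> = c - d\<close> by linarith
      ultimately show False using perturb[OF abs_of_pos[OF \<epsilon>(1)]] by blast
    next
      case False
      then have "4 * \<delta> = d - c" by (simp add: \<delta>_def)
      obtain x where x: "\<And>y. (W y - w y) - \<epsilon> * sqrt (1 + y\<^sup>2) \<le> (W x - w x) - \<epsilon> * sqrt (1 + x\<^sup>2)"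
        using touching_point[OF continuous_on_diff[OF contW contw] _ \<epsilon>(1), of B] B
        by (auto simp: abs_minus_commute)
      have "\<forall>\<^sub>F y in nhds x. w x - (W x + - \<epsilon> * sqrt (1 + x\<^sup>2)) \<le> w y - (W y + - \<epsilon> * sqrt (1 + y\<^sup>2))"
      proof (intro always_eventually allI)
        fix y show "w x - (W x + - \<epsilon> * sqrt (1 + x\<^sup>2)) \<le> w y - (W y + - \<epsilon> * sqrt (1 + y\<^sup>2))"
          using x[of y] by linarith
      qed
      from viscosity_geD[OF super touch[of "- \<epsilon>"] this]
      have "d - \<delta> \<le> 1/2 * \<bar>p + (W' x + - \<epsilon> * (x / sqrt (1 + x\<^sup>2)))\<bar>\<^sup>2 - V x" .
      moreover have False if "\<bar>q - c\<bar> \<le> 2 * \<delta>" "d - \<delta> \<le> q" for q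
        using that \<delta> \<open>4 * \<delta> = d - c\<close> by linarith
      moreover have "\<bar>- \<epsilon>\<bar> = \<epsilon>" using \<epsilon>(1) by simp
      ultimately show False using perturb by blast
    qed
  qed
qed

text \<open>The function \<open>f = sqrt (2 * (h + u))\<close> satisfies
  \<open>f\<^sup>2 / 2 - u = h\<close> exactly, so prescribing \<open>p + W' = P\<close> with
  \<open>P\<close> close to \<open>f\<close> leaves a small error. \<open>W\<close> is bounded
  because \<open>P\<close> has mean \<open>p\<close>.\<close>

lemma smooth_corrector_exists:
  assumes "non_resonant \<xi>" "continuous_on {0..4} u" "\<And>t. t \<in> {0..4} \<Longrightarrow> 0 \<le> h + u t" "\<delta> > 0"
    and p: "p = torus_integral (\<lambda>x. sqrt (2 * (h + u (well \<theta> x))))"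
  shows "\<exists>W W'. smooth_corrector (\<lambda>x. u (well \<theta> (x *\<^sub>R \<xi>))) p h \<delta> W W'"
proof -
  define f where "f t = sqrt (2 * (h + u t))" for t
  have contf: "continuous_on {0..4} f" unfolding f_def by (intro continuous_intros assms(2))
  then have "bounded (f ` {0..4})" by (simp add: compact_continuous_image compact_imp_bounded)
  then obtain M where M: "\<And>t. t \<in> {0..4} \<Longrightarrow> \<bar>f t\<bar> \<le> M"
    by (metis bounded_iff image_eqI real_norm_def)
  have M0: "M \<ge> 0" using M[of 0] by auto
  obtain \<epsilon> where \<epsilon>: "\<epsilon> > 0" "\<epsilon> \<le> 1" "\<epsilon> * (M + 1) \<le> \<delta>"
    by (rule small_factor[OF \<open>\<delta> > 0\<close> M0])
  obtain P where P: "trig_poly P" "\<And>x. \<bar>P x - f (well \<theta> x)\<bar> \<le> \<epsilon>" "torus_integral P = p"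
    using trig_poly_approx[OF contf \<epsilon>(1)] unfolding p f_def by metis
  obtain W B where W: "\<And>x. \<bar>W x\<bar> \<le> B" "\<And>x. (W has_real_derivative P (x *\<^sub>R \<xi>) - p) (at x)"
    using trig_poly_antiderivative[OF assms(1) P(1)] P(3) by auto
  obtain K where K: "\<And>x. \<bar>P x\<bar> \<le> K" using trig_poly_bounded[OF P(1)] by blast
  have "smooth_corrector (\<lambda>x. u (well \<theta> (x *\<^sub>R \<xi>))) p h \<delta> W (\<lambda>x. P (x *\<^sub>R \<xi>) - p)"
    unfolding smooth_corrector_def
  proof (intro conjI allI W(2))
    show "bounded (range W)" using W(1) by (auto simp: bounded_iff)
    have "\<bar>P (x *\<^sub>R \<xi>) - p\<bar> \<le> K + \<bar>p\<bar>" for x using K[of "x *\<^sub>R \<xi>"] by linarith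
    then show "bounded (range (\<lambda>x. P (x *\<^sub>R \<xi>) - p))" by (auto simp: bounded_iff)
    show "continuous_on UNIV (\<lambda>x. P (x *\<^sub>R \<xi>) - p)"
      by (intro continuous_intros continuous_on_compose2[OF trig_poly_continuous[OF P(1)]]) auto
    fix x
    let ?y = "x *\<^sub>R \<xi>" let ?t = "well \<theta> ?y"
    have t: "?t \<in> {0..4}" by (simp add: well_range)
    have "1/2 * (f ?t)\<^sup>2 = h + u ?t" unfolding f_def using assms(3)[OF t] by simp
    moreover have "\<bar>1/2 * (f ?t + (P ?y - f ?t))\<^sup>2 - 1/2 * (f ?t)\<^sup>2\<bar> \<le> \<delta>"
      using square_half_perturb[OF M[OF t] P(2)[of ?y] \<epsilon>(2)] \<epsilon>(3) by linarith
    moreover have "p + (P ?y - p) = f ?t + (P ?y - f ?t)" by simp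
    ultimately show "\<bar>1/2 * (p + (P ?y - p))\<^sup>2 - u ?t - h\<bar> \<le> \<delta>"
      by (simp only: diff_diff_eq add.commute)
  qed
  then show ?thesis by blast
qed

section \<open>Moments of the energy\<close>

text \<open>A quarter period to the left is written as three quarters to the right, so that the
  shift lies in \<open>[0, 1]\<close>.\<close>

lemma cos_shift: "cos (2 * pi * x - pi / 2) = cos (2 * pi * (x + 3/4))"
proof -
  have "2 * pi * (x + 3/4) = (2 * pi * x - pi / 2) + 2 * pi" by (simp add: algebra_simps)
  then show ?thesis by (simp only: cos_periodic)
qed

lemma integral_periodic_shift:
  fixes f :: "real \<Rightarrow> real"
  assumes "continuous_on UNIV f" "\<And>x. f (x + 1) = f x" "0 \<le> c" "c \<le> 1"
  shows "integral {0..1} (\<lambda>x. f (x + c)) = integral {0..1} f"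
proof -
  have int: "f integrable_on {a..b}" for a b
    by (intro integrable_continuous_interval continuous_on_subset[OF assms(1)]) simp
  have "integral {0..1} (\<lambda>x. f (x + c)) = integral {c..c + 1} f"
    using integral_shift_real_ivl[of c c "c + 1" f] by simp
  also have "\<dots> = integral {c..1} f + integral {1..c + 1} f"
    using Henstock_Kurzweil_Integration.integral_combine[where a = c and c = 1 and b = "c + 1" and f = f] assms int by simp
  also have "integral {1..c + 1} f = integral {0..c} f"
    using integral_shift_real_ivl[of 1 1 "c + 1" f] assms(2) by simp
  also have "integral {c..1} f + integral {0..c} f = integral {0..1} f"
    using Henstock_Kurzweil_Integration.integral_combine[where a = 0 and c = c and b = 1 and f = f] assms int by simp
  finally show ?thesis .
qed

lemma continuous_on_param_integral:
  fixes f :: "real \<times> real \<Rightarrow> real"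
  assumes "continuous_on UNIV f"
  shows "continuous_on UNIV (\<lambda>x. integral {0..1} (\<lambda>y. f (x, y)))"
proof -
  have "continuous_on (UNIV \<times> cbox 0 (1::real)) (\<lambda>(x, y). f (x, y))"
    using continuous_on_subset[OF assms] by (simp add: case_prod_unfold)
  from integral_continuous_on_param[OF this] show ?thesis by simp
qed

text \<open>The sine well is a translate of the cosine well; in the iterated integral the shift is
  undone one coordinate at a time. Hence moments need to be estimated for phase \<open>0\<close>
  only.\<close>

lemma torus_integral_well_shift:
  assumes "continuous_on {0..4} f"
  shows "torus_integral (\<lambda>x. f (well (- (pi / 2)) x)) = torus_integral (\<lambda>x. f (well 0 x))"
proof -
  define F where "F x y = f (well 0 (x, y))" for x y
  have cont: "continuous_on UNIV (\<lambda>x. f (well \<theta> x))" for \<theta>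
    by (rule continuous_on_comp_well[OF assms])
  have contF: "continuous_on UNIV (\<lambda>y. F x y)" for x
    unfolding F_def by (rule continuous_on_compose2[OF cont[of 0]]) (auto intro!: continuous_intros)
  have per: "F (x + 1) y = F x y" "F x (y + 1) = F x y" for x y
    by (simp_all add: F_def well_def distrib_left)
  have shift: "f (well (- (pi / 2)) (x, y)) = F (x + 3/4) (y + 3/4)" for x y
    using cos_shift[of x] cos_shift[of y] by (simp add: F_def well_def)
  have "torus_integral (\<lambda>x. f (well (- (pi / 2)) x))
      = integral {0..1} (\<lambda>x. integral {0..1} (\<lambda>y. F (x + 3/4) (y + 3/4)))"
    by (subst torus_integral_iterated[OF cont]) (simp add: shift)
  also have "\<dots> = integral {0..1} (\<lambda>x. integral {0..1} (\<lambda>y. F (x + 3/4) y))"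
    using integral_periodic_shift[OF contF per(2), of "3/4"] by simp
  also have "\<dots> = integral {0..1} (\<lambda>x. integral {0..1} (\<lambda>y. F x y))"
  proof (rule integral_periodic_shift)
    show "continuous_on UNIV (\<lambda>x. integral {0..1} (\<lambda>y. F x y))"
      unfolding F_def by (rule continuous_on_param_integral[OF cont])
  qed (simp_all add: per)
  also have "\<dots> = torus_integral (\<lambda>x. f (well 0 x))"
    by (simp only: torus_integral_iterated[OF cont] F_def)
  finally show ?thesis .
qed

section \<open>Differentiability, continuity and range of the moments\<close>

text \<open>The exponents \<open>1/2\<close>, \<open>- 1/2\<close> and \<open>- 3/2\<close> give the
  functions \<open>G\<close>, \<open>g\<close> and \<open>I\<close> of the overview.\<close>

definition energy_moment :: "real \<Rightarrow> real \<Rightarrow> real \<Rightarrow> real \<Rightarrow> real" where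
  "energy_moment \<theta> \<gamma> s h = torus_integral (\<lambda>x. (2 * (h + well \<theta> x powr \<gamma>)) powr s)"

lemma continuous_on_powr_pos:
  fixes \<gamma> :: real
  assumes "\<gamma> > 0"
  shows "continuous_on {0..} (\<lambda>t. t powr \<gamma>)"
  using assms by (intro continuous_on_powr' continuous_intros) auto

lemma continuous_on_well_powr:
  assumes "\<gamma> > 0"
  shows "continuous_on S (\<lambda>x. well \<theta> x powr \<gamma>)"
  by (rule continuous_on_compose2[OF continuous_on_powr_pos[OF assms] continuous_on_well])
    (auto simp: well_range)

lemma continuous_on_moment_integrand:
  fixes \<gamma> h s :: real
  assumes "\<gamma> > 0" "h > 0"
  shows "continuous_on {0..4} (\<lambda>t. (2 * (h + t powr \<gamma>)) powr s)"
proof -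
  have "2 * (h + t powr \<gamma>) > 0" for t :: real by (simp add: add_pos_nonneg assms(2))
  then have "2 * (h + t powr \<gamma>) \<noteq> 0" for t :: real by (metis less_irrefl)
  moreover have "continuous_on {0..4} (\<lambda>t. 2 * (h + t powr \<gamma>))"
    by (intro continuous_on_mult continuous_on_add continuous_on_const
        continuous_on_subset[OF continuous_on_powr_pos[OF assms(1)]]) auto
  ultimately show ?thesis by (intro continuous_on_powr continuous_on_const) auto
qed

lemma continuous_moment:
  assumes "\<gamma> > 0" "h > 0"
  shows "continuous_on UNIV (\<lambda>x. (2 * (h + well \<theta> x powr \<gamma>)) powr s)"
  by (rule continuous_on_comp_well[of "\<lambda>t. (2 * (h + t powr \<gamma>)) powr s"])
    (rule continuous_on_moment_integrand, use assms in auto)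

lemma energy_moment_shift:
  assumes "\<gamma> > 0" "h > 0"
  shows "energy_moment (- (pi / 2)) \<gamma> s h = energy_moment 0 \<gamma> s h"
  unfolding energy_moment_def
  by (rule torus_integral_well_shift[of "\<lambda>t. (2 * (h + t powr \<gamma>)) powr s"])
    (rule continuous_on_moment_integrand, use assms in auto)

lemma powr_affine_deriv:
  fixes h u s :: real
  assumes "h + u > 0"
  shows "((\<lambda>h. (2 * (h + u)) powr s) has_real_derivative 2 * s * (2 * (h + u)) powr (s - 1)) (at h within A)"
proof -
  have "((\<lambda>h. 2 * (h + u)) has_real_derivative 2) (at h within A)"
    by (auto intro!: derivative_eq_intros)
  moreover have "((\<lambda>z. z powr s) has_real_derivative s * (2 * (h + u)) powr (s - 1)) (at (2 * (h + u)))"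
    using assms by (intro has_real_derivative_powr) simp
  ultimately show ?thesis
    using DERIV_chain' by (fastforce simp: mult_ac)
qed

text \<open>Differentiation under the integral over \<open>h > 0\<close>, where the energy is
  positive and the differentiated integrand is jointly continuous. The factor \<open>2 * s\<close>
  is \<open>1\<close> and \<open>- 1\<close> for the two exponents that matter.\<close>

lemma energy_moment_deriv:
  assumes "\<gamma> > 0" "h > 0"
  shows "(energy_moment \<theta> \<gamma> s has_real_derivative 2 * s * energy_moment \<theta> \<gamma> (s - 1) h) (at h)"
proof -
  have pos: "k + well \<theta> x powr \<gamma> > 0" if "k > 0" for k x
    using that powr_ge_zero[of "well \<theta> x" \<gamma>] by linarith
  have "((\<lambda>h. integral (cbox (0,0) (1,1)) (\<lambda>x. (2 * (h + well \<theta> x powr \<gamma>)) powr s)) has_real_derivative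
    integral (cbox (0,0) (1,1)) (\<lambda>x. 2 * s * (2 * (h + well \<theta> x powr \<gamma>)) powr (s - 1))) (at h within {0<..})"
  proof (rule leibniz_rule_field_derivative)
    fix k :: real and x assume k: "k \<in> {0<..}"
    then show "((\<lambda>h. (2 * (h + well \<theta> x powr \<gamma>)) powr s) has_real_derivative
        2 * s * (2 * (k + well \<theta> x powr \<gamma>)) powr (s - 1)) (at k within {0<..})"
      using pos[of k x] by (intro powr_affine_deriv) auto
    show "(\<lambda>x. (2 * (k + well \<theta> x powr \<gamma>)) powr s) integrable_on cbox (0, 0) (1, 1)"
      using integrable_on_torus[OF continuous_moment[OF assms(1), of k \<theta> s]] k
      by (simp add: unit_square)
  next
    let ?S = "{0<..} \<times> cbox (0, 0) (1, 1) :: (real \<times> real \<times> real) set"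
    have nonzero: "2 * (fst z + well \<theta> (snd z) powr \<gamma>) \<noteq> 0" if "z \<in> ?S" for z
      using pos[of "fst z" "snd z"] that by (cases z) auto
    have "continuous_on ?S (\<lambda>z. well \<theta> (snd z) powr \<gamma>)"
      by (rule continuous_on_compose2[OF continuous_on_well_powr[OF assms(1), of UNIV]])
        (auto intro: continuous_intros)
    then have "continuous_on ?S (\<lambda>z. 2 * (fst z + well \<theta> (snd z) powr \<gamma>))"
      by (intro continuous_on_mult continuous_on_add continuous_on_const continuous_on_fst continuous_on_id)
    from continuous_on_mult[OF continuous_on_const
        continuous_on_powr[OF this continuous_on_const ballI[OF nonzero]]]
    have "continuous_on ?S (\<lambda>z. 2 * s * (2 * (fst z + well \<theta> (snd z) powr \<gamma>)) powr (s - 1))" .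
    then show "continuous_on ?S (\<lambda>(h, x). 2 * s * (2 * (h + well \<theta> x powr \<gamma>)) powr (s - 1))"
      unfolding case_prod_unfold .
  qed (use assms in auto)
  then show ?thesis
    using assms(2) unfolding energy_moment_def torus_integral_def unit_square
    by (simp add: at_within_open[of h "{0<..}"])
qed

lemma energy_moment_half:
  "h \<ge> 0 \<Longrightarrow> energy_moment \<theta> \<gamma> (1/2) h = torus_integral (\<lambda>x. sqrt (2 * (h + well \<theta> x powr \<gamma>)))"
  by (simp add: energy_moment_def powr_half_sqrt)

lemma well_powr_le: "\<gamma> > 0 \<Longrightarrow> well \<theta> x powr \<gamma> \<le> 4 powr \<gamma>"
  by (intro powr_mono2) (auto simp: well_range)

lemma energy_moment_bounds:
  assumes "\<gamma> > 0" "h > 0" "s \<le> 0"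
  shows "energy_moment \<theta> \<gamma> s h \<le> (2 * h) powr s"
    and "(2 * (h + 4 powr \<gamma>)) powr s \<le> energy_moment \<theta> \<gamma> s h"
proof -
  have "energy_moment \<theta> \<gamma> s h \<le> torus_integral (\<lambda>x. (2 * h) powr s)"
    unfolding energy_moment_def
    by (intro torus_integral_mono continuous_moment assms continuous_intros powr_mono2')
      (use assms in auto)
  then show "energy_moment \<theta> \<gamma> s h \<le> (2 * h) powr s" by (simp add: torus_integral_const)
  have "torus_integral (\<lambda>x. (2 * (h + 4 powr \<gamma>)) powr s) \<le> energy_moment \<theta> \<gamma> s h"
    unfolding energy_moment_def
  proof (intro torus_integral_mono continuous_moment assms continuous_intros powr_mono2')
    show "0 < 2 * (h + well \<theta> x powr \<gamma>)" for x
      by (simp add: add_pos_nonneg assms(2))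
  qed (use assms well_powr_le in auto)
  then show "(2 * (h + 4 powr \<gamma>)) powr s \<le> energy_moment \<theta> \<gamma> s h" by (simp add: torus_integral_const)
qed

text \<open>Positive levels are covered by the derivative. At \<open>0\<close>, subadditivity of the
  square root squeezes \<open>?G k\<close> between \<open>?G 0\<close> and
  \<open>?G 0 + sqrt (2 * k)\<close>.\<close>

lemma energy_moment_continuous:
  assumes "\<gamma> > 0"
  shows "continuous_on {0..} (energy_moment \<theta> \<gamma> (1/2))"
proof -
  let ?G = "energy_moment \<theta> \<gamma> (1/2)"
  have "(?G \<longlongrightarrow> ?G h) (at h within {0..})" if "h \<ge> 0" for h
  proof (cases "h = 0")
    case False
    then show ?thesis
      using DERIV_isCont[OF energy_moment_deriv[OF assms, of h]] that
      by (simp add: isCont_def tendsto_within_subset[of _ _ _ UNIV])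
  next
    case True
    have cont: "continuous_on UNIV (\<lambda>x. sqrt (2 * (k + well \<theta> x powr \<gamma>)))" for k
      by (intro continuous_on_real_sqrt continuous_on_mult continuous_on_add continuous_on_const
          continuous_on_well_powr assms)
    have "?G k \<le> ?G 0 + sqrt (2 * k)" and "?G 0 \<le> ?G k" if "k \<ge> 0" for k
    proof -
      have "?G k \<le> torus_integral (\<lambda>x. sqrt (2 * (0 + well \<theta> x powr \<gamma>)) + sqrt (2 * k))"
        unfolding energy_moment_half[OF that]
      proof (intro torus_integral_mono continuous_on_add continuous_on_const cont)
        show "sqrt (2 * (k + well \<theta> x powr \<gamma>)) \<le> sqrt (2 * (0 + well \<theta> x powr \<gamma>)) + sqrt (2 * k)" for x
          using sqrt_add_le_add_sqrt[of "2 * well \<theta> x powr \<gamma>" "2 * k"] that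
          by (simp add: algebra_simps)
      qed
      also have "\<dots> = ?G 0 + sqrt (2 * k)"
        by (subst torus_integral_add[OF cont]) (auto simp: torus_integral_const energy_moment_half)
      finally show "?G k \<le> ?G 0 + sqrt (2 * k)" .
      show "?G 0 \<le> ?G k"
        unfolding energy_moment_half[OF that] energy_moment_half[OF order_refl]
        using that by (intro torus_integral_mono cont) simp
    qed
    then have sandwich: "\<forall>\<^sub>F k in at 0 within {0..}. ?G 0 \<le> ?G k"
      "\<forall>\<^sub>F k in at 0 within {0..}. ?G k \<le> ?G 0 + sqrt (2 * k)"
      by (auto simp: eventually_at_filter)
    have lim: "((\<lambda>k. ?G 0 + sqrt (2 * k)) \<longlongrightarrow> ?G 0) (at 0 within {0..})"
      using tendsto_add[OF tendsto_const tendsto_real_sqrt[OF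
          tendsto_mult[OF tendsto_const tendsto_ident_at]], of "?G 0" 2 0 "{0..}"] by simp
    show ?thesis unfolding True by (rule tendsto_sandwich[OF sandwich tendsto_const lim])
  qed
  then show ?thesis by (simp add: continuous_on)
qed

lemma energy_moment_half_ge:
  assumes "\<gamma> > 0" "h \<ge> 0"
  shows "sqrt (2 * h) \<le> energy_moment \<theta> \<gamma> (1/2) h"
proof -
  have "torus_integral (\<lambda>_. sqrt (2 * h)) \<le> torus_integral (\<lambda>x. sqrt (2 * (h + well \<theta> x powr \<gamma>)))"
    using assms by (intro torus_integral_mono continuous_on_real_sqrt continuous_on_mult
        continuous_on_add continuous_on_const continuous_on_well_powr) auto
  then show ?thesis using assms by (simp add: torus_integral_const energy_moment_half)
qed

text \<open>Intermediate value theorem: the growth bound makes \<open>p\<^sup>2 / 2\<close> a level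
  at which the moment has reached \<open>p\<close>.\<close>

lemma energy_moment_surj:
  assumes "\<gamma> > 0" "energy_moment \<theta> \<gamma> (1/2) 0 \<le> p"
  shows "\<exists>h\<ge>0. energy_moment \<theta> \<gamma> (1/2) h = p"
proof -
  have "p \<ge> 0" using energy_moment_half_ge[OF assms(1), of 0 \<theta>] assms(2) by simp
  then have "p \<le> energy_moment \<theta> \<gamma> (1/2) (p\<^sup>2 / 2)"
    using energy_moment_half_ge[OF assms(1), of "p\<^sup>2 / 2" \<theta>] by simp
  from IVT'[OF assms(2) this _ continuous_on_subset[OF energy_moment_continuous[OF assms(1)]]]
  show ?thesis by auto
qed

section \<open>Size of the moments near the zero level\<close>

text \<open>Taylor gives \<open>sin y \<ge> y - y^3 / 6\<close>, which is at least
  \<open>y / 3\<close> for \<open>0 \<le> y \<le> 2\<close>; the rough bounds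
  \<open>2 \<le> pi < 4\<close> do the rest.\<close>

lemma sin_pi_ge:
  assumes "0 \<le> d" "d \<le> 1/2"
  shows "2/3 * d \<le> sin (pi * d)"
proof -
  let ?y = "pi * d"
  have y: "0 \<le> ?y" "?y \<le> 2" using assms pi_less_4 mult_mono[of pi 4 d "1/2"] by auto
  have "\<bar>sin ?y - (\<Sum>m<3. sin_coeff m * ?y ^ m)\<bar> \<le> inverse (fact 3) * \<bar>?y\<bar> ^ 3"
    by (rule Maclaurin_sin_bound)
  moreover have "(\<Sum>m<3. sin_coeff m * ?y ^ m) = ?y"
    by (simp add: numeral_3_eq_3 sin_coeff_def)
  moreover have "inverse (fact 3) * \<bar>?y\<bar> ^ 3 = ?y * ?y\<^sup>2 / 6"
    using y by (simp add: fact_numeral power3_eq_cube power2_eq_square)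
  ultimately have "?y - ?y * ?y\<^sup>2 / 6 \<le> sin ?y" by linarith
  moreover have "?y * ?y\<^sup>2 \<le> ?y * 4"
    using y power_mono[of ?y 2 2] by (intro mult_left_mono) auto
  moreover have "2 * d \<le> pi * d" using assms pi_ge_two by (intro mult_right_mono) auto
  ultimately show ?thesis by linarith
qed

lemma one_minus_cos: "1 - cos (2 * pi * x) = 2 * (sin (pi * x))\<^sup>2"
  using cos_double_sin[of "pi * x"] by (simp add: mult.assoc)

text \<open>On \<open>[0, 1]\<close> this is the distance to the nearest zero of
  \<open>1 - cos (2 * pi * x)\<close>, both end points being zeros.\<close>

definition edge_dist :: "real \<Rightarrow> real" where "edge_dist x = min x (1 - x)"

lemma edge_dist_range: "0 \<le> x \<Longrightarrow> x \<le> 1 \<Longrightarrow> 0 \<le> edge_dist x \<and> edge_dist x \<le> 1/2"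
  by (simp add: edge_dist_def min_def)

lemma one_minus_cos_ge:
  assumes "0 \<le> x" "x \<le> 1"
  shows "(edge_dist x)\<^sup>2 / 2 \<le> 1 - cos (2 * pi * x)"
proof -
  have "sin (pi * (1 - x)) = sin (pi * x)" by (simp add: right_diff_distrib sin_diff)
  then have "2/3 * edge_dist x \<le> sin (pi * x)"
    using sin_pi_ge[of x] sin_pi_ge[of "1 - x"] assms by (auto simp: edge_dist_def min_def)
  then have "(2/3 * edge_dist x)\<^sup>2 \<le> (sin (pi * x))\<^sup>2"
    using edge_dist_range[OF assms] by (intro power_mono) auto
  then have "4/9 * (edge_dist x)\<^sup>2 \<le> (sin (pi * x))\<^sup>2" by (simp add: power_mult_distrib power2_eq_square)
  then show ?thesis unfolding one_minus_cos using zero_le_power2[of "edge_dist x"] by linarith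
qed

lemma one_minus_cos_le: "1 - cos (2 * pi * x) \<le> 32 * x\<^sup>2"
proof -
  have "\<bar>sin (pi * x)\<bar> \<le> \<bar>pi * x\<bar>" by (rule abs_sin_x_le_abs_x)
  also have "\<dots> \<le> 4 * \<bar>x\<bar>" using pi_less_4 by (auto simp: abs_mult intro!: mult_right_mono)
  finally have "(sin (pi * x))\<^sup>2 \<le> (4 * \<bar>x\<bar>)\<^sup>2" using power_mono[of "\<bar>sin (pi * x)\<bar>" "4 * \<bar>x\<bar>" 2] by simp
  then show ?thesis unfolding one_minus_cos by (simp add: power_mult_distrib)
qed

section \<open>Integrals of the singular model\<close>

text \<open>For \<open>h = k powr (2 * \<gamma>)\<close>, \<open>k\<close> is the length scale on
  which the potential reaches the size of \<open>h\<close>. Comparison with the maximum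
  \<open>m\<close> allows adding squares before taking the power \<gamma>, whether \<gamma> is above
  or below one.\<close>

lemma energy_ge:
  assumes "\<gamma> > 0" "0 < k" "x \<in> {0..1} \<times> {0..1}"
  shows "12 powr (- \<gamma>) * (k + edge_dist (fst x) + edge_dist (snd x)) powr (2 * \<gamma>)
    \<le> k powr (2 * \<gamma>) + well 0 x powr \<gamma>"
proof -
  define a b where "a = edge_dist (fst x)" and "b = edge_dist (snd x)"
  have ab: "0 \<le> a" "0 \<le> b" using assms(3) edge_dist_range by (auto simp: a_def b_def)
  have w: "a\<^sup>2 / 2 + b\<^sup>2 / 2 \<le> well 0 x"
    using assms(3) one_minus_cos_ge[of "fst x"] one_minus_cos_ge[of "snd x"]
    by (auto simp: well_def a_def b_def)
  define m where "m = max (k\<^sup>2) (well 0 x)"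
  have m: "k\<^sup>2 \<le> m" "well 0 x \<le> m" by (simp_all add: m_def)
  have "(k + a + b)\<^sup>2 \<le> 3 * (k\<^sup>2 + a\<^sup>2 + b\<^sup>2)"
    using zero_le_power2[of "k - a"] zero_le_power2[of "k - b"] zero_le_power2[of "a - b"]
    by (simp add: power2_eq_square algebra_simps)
  also have "\<dots> \<le> 12 * m" using w m zero_le_power2[of k] unfolding distrib_left by linarith
  finally have "((k + a + b)\<^sup>2) powr \<gamma> \<le> (12 * m) powr \<gamma>"
    using assms(1) by (intro powr_mono2) auto
  moreover have "((k + a + b)\<^sup>2) powr \<gamma> = (k + a + b) powr (2 * \<gamma>)"
    using ab assms(2) by (simp add: powr_powr flip: powr_numeral)
  moreover have "(12 * m) powr \<gamma> = 12 powr \<gamma> * m powr \<gamma>"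
    by (rule powr_mult)
  moreover have "m powr \<gamma> \<le> k powr (2 * \<gamma>) + well 0 x powr \<gamma>"
  proof -
    have "(k\<^sup>2) powr \<gamma> = k powr (2 * \<gamma>)"
      using assms(2) by (simp add: powr_powr flip: powr_numeral)
    then show ?thesis unfolding m_def max_def by simp
  qed
  then have "12 powr \<gamma> * m powr \<gamma> \<le> 12 powr \<gamma> * (k powr (2 * \<gamma>) + well 0 x powr \<gamma>)"
    by (rule mult_left_mono) simp
  ultimately have "(k + a + b) powr (2 * \<gamma>) \<le> 12 powr \<gamma> * (k powr (2 * \<gamma>) + well 0 x powr \<gamma>)"
    by linarith
  then show ?thesis unfolding a_def b_def
    by (simp add: powr_minus field_simps)
qed

text \<open>\<open>edge_dist x\<close> is \<open>x\<close> or \<open>1 - x\<close>, so the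
  nonnegative integrand is at most the sum of both branches, and each branch is integrated exactly
  by the primitive \<open>F\<close>.\<close>

lemma integral_edge_dist_le:
  assumes "a > 0" "\<And>s. s > 0 \<Longrightarrow> (F has_real_derivative \<psi> s) (at s)"
    "continuous_on {0<..} \<psi>" "\<And>s. s > 0 \<Longrightarrow> 0 \<le> \<psi> s"
  shows "integral {0..1} (\<lambda>x. \<psi> (a + edge_dist x)) \<le> 2 * (F (a + 1) - F a)"
proof -
  have "((\<lambda>x. F (a + x)) has_real_derivative \<psi> (a + x)) (at x within {0..1})"
    and "((\<lambda>x. - F (a + (1 - x))) has_real_derivative \<psi> (a + (1 - x))) (at x within {0..1})"
    if "x \<in> {0..1}" for x
  proof -
    have "((\<lambda>x. a + x) has_real_derivative 1) (at x within {0..1})"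
      "((\<lambda>x. a + (1 - x)) has_real_derivative - 1) (at x within {0..1})"
      by (auto intro!: derivative_eq_intros)
    from this[THEN DERIV_chain', OF assms(2)]
    show "((\<lambda>x. F (a + x)) has_real_derivative \<psi> (a + x)) (at x within {0..1})"
      "((\<lambda>x. - F (a + (1 - x))) has_real_derivative \<psi> (a + (1 - x))) (at x within {0..1})"
      using that assms(1) by (auto intro!: derivative_eq_intros)
  qed
  then have "((\<lambda>x. \<psi> (a + x)) has_integral F (a + 1) - F (a + 0)) {0..1}"
    "((\<lambda>x. \<psi> (a + (1 - x))) has_integral (- F (a + (1 - 1))) - (- F (a + (1 - 0)))) {0..1}"
    by (intro fundamental_theorem_of_calculus; simp flip: has_real_derivative_iff_has_vector_derivative)+
  from has_integral_add[OF this]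
  have "((\<lambda>x. \<psi> (a + x) + \<psi> (a + (1 - x))) has_integral 2 * (F (a + 1) - F a)) {0..1}"
    by (simp add: algebra_simps)
  moreover have "(\<lambda>x. \<psi> (a + edge_dist x)) integrable_on {0..1}"
  proof (intro integrable_continuous_interval continuous_on_compose2[OF assms(3)])
    show "continuous_on {0..1} (\<lambda>x. a + edge_dist x)"
      unfolding edge_dist_def by (intro continuous_intros)
  qed (use assms(1) in \<open>auto simp: edge_dist_def\<close>)
  moreover have "\<psi> (a + edge_dist x) \<le> \<psi> (a + x) + \<psi> (a + (1 - x))" if "x \<in> {0..1}" for x
    using assms(4)[of "a + x"] assms(4)[of "a + (1 - x)"] assms(1) that
    by (auto simp: edge_dist_def min_def)
  ultimately show ?thesis by (meson has_integral_le integrable_integral)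
qed

lemma divide_flip_diff: "A / (1 - b) - B / (1 - b) = (B - A) / (b - 1 :: real)"
  by (metis diff_divide_distrib minus_diff_eq minus_divide_divide)

lemma continuous_on_powr_greaterThan: "continuous_on {0<..} (\<lambda>s::real. s powr b)"
  by (intro continuous_on_powr continuous_intros) auto

lemma powr_antiderivative:
  fixes b s :: real
  assumes "b \<noteq> 1" "s > 0"
  shows "((\<lambda>s. s powr (1 - b) / (1 - b)) has_real_derivative s powr (- b)) (at s)"
  using DERIV_cdivide[OF has_real_derivative_powr[OF assms(2), of "1 - b"], of "1 - b"] assms by simp

text \<open>Model for the moment of order \<open>- 3/2\<close>: by \<open>energy_ge\<close> its
  integrand is at most a constant times this one with \<open>b = 3 * \<gamma>\<close>.\<close>

definition corner_integral :: "real \<Rightarrow> real \<Rightarrow> real" where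
  "corner_integral b k = integral ({0..1} \<times> {0..1}) (\<lambda>x. (k + edge_dist (fst x) + edge_dist (snd x)) powr (- b))"

lemma continuous_on_corner:
  assumes "k > 0"
  shows "continuous_on ({0..1} \<times> {0..1}) (\<lambda>x. (k + edge_dist (fst x) + edge_dist (snd x)) powr (- b))"
proof (intro continuous_on_powr continuous_on_const)
  show "continuous_on ({0..1} \<times> {0..1}) (\<lambda>x. k + edge_dist (fst x) + edge_dist (snd x))"
    unfolding edge_dist_def by (intro continuous_intros)
  show "\<forall>x\<in>{0..1} \<times> {0..1}. k + edge_dist (fst x) + edge_dist (snd x) \<noteq> 0"
  proof
    fix x :: "real \<times> real" assume "x \<in> {0..1} \<times> {0..1}"
    then show "k + edge_dist (fst x) + edge_dist (snd x) \<noteq> 0"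
      using edge_dist_range[of "fst x"] edge_dist_range[of "snd x"] assms by auto
  qed
qed

text \<open>Each of two one-dimensional integrations raises the exponent by one. The second
  primitive \<open>F\<close> is left open because it is a logarithm for \<open>b = 2\<close> and a
  power otherwise.\<close>

lemma corner_integral_le:
  assumes "k > 0" "b > 1" "\<And>s. s > 0 \<Longrightarrow> (F has_real_derivative s powr (1 - b)) (at s)"
  shows "corner_integral b k \<le> 4 / (b - 1) * (F (k + 1) - F k)"
proof -
  define inner where "inner x = integral {0..1} (\<lambda>y. (k + edge_dist x + edge_dist y) powr (- b))" for x
  have inner_le: "inner x \<le> 2 / (b - 1) * (k + edge_dist x) powr (1 - b)" if "x \<in> {0..1}" for x
  proof -
    have pos: "k + edge_dist x > 0" using edge_dist_range[of x] that assms(1) by auto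
    have "inner x \<le> 2 * ((k + edge_dist x + 1) powr (1 - b) / (1 - b) - (k + edge_dist x) powr (1 - b) / (1 - b))"
      unfolding inner_def
      by (rule integral_edge_dist_le[OF pos powr_antiderivative])
        (use assms in \<open>auto intro: continuous_on_powr_greaterThan\<close>)
    also have "\<dots> = 2 / (b - 1) * ((k + edge_dist x) powr (1 - b) - (k + edge_dist x + 1) powr (1 - b))"
      unfolding divide_flip_diff by simp
    also have "\<dots> \<le> 2 / (b - 1) * (k + edge_dist x) powr (1 - b)"
      using assms(2) by (intro mult_left_mono) auto
    finally show ?thesis .
  qed
  have "continuous_on (cbox (0, 0) (1, 1)) (\<lambda>x. (k + edge_dist (fst x) + edge_dist (snd x)) powr (- b))"
    using continuous_on_corner[OF assms(1)] by (simp add: unit_square)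
  note cont = this
  have "corner_integral b k = integral {0..1} inner"
    unfolding corner_integral_def unit_square using integral_prod_continuous[OF cont]
    by (simp add: inner_def[abs_def])
  also have "\<dots> \<le> integral {0..1} (\<lambda>x. 2 / (b - 1) * (k + edge_dist x) powr (1 - b))"
  proof (rule integral_le[OF _ _ inner_le])
    have "continuous_on (cbox 0 1 \<times> cbox 0 1) (\<lambda>(x, y). (k + edge_dist x + edge_dist y) powr (- b))"
      using continuous_on_corner[OF assms(1)] by (simp add: case_prod_unfold)
    from integral_continuous_on_param[OF this] have "continuous_on {0..1} inner"
      by (simp add: inner_def[abs_def])
    then show "inner integrable_on {0..1}" by (rule integrable_continuous_interval)
    have "continuous_on {0..1} (\<lambda>x. (k + edge_dist x) powr (1 - b))"
    proof (rule continuous_on_compose2[OF continuous_on_powr_greaterThan])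
      show "continuous_on {0..1} (\<lambda>x. k + edge_dist x)"
        unfolding edge_dist_def by (intro continuous_intros)
    qed (use assms(1) in \<open>auto simp: edge_dist_def\<close>)
    then show "(\<lambda>x. 2 / (b - 1) * (k + edge_dist x) powr (1 - b)) integrable_on {0..1}"
      by (intro integrable_continuous_interval continuous_on_mult continuous_on_const)
  qed
  also have "\<dots> = 2 / (b - 1) * integral {0..1} (\<lambda>x. (k + edge_dist x) powr (1 - b))" by simp
  also have "\<dots> \<le> 2 / (b - 1) * (2 * (F (k + 1) - F k))"
    using assms(2)
    by (intro mult_left_mono integral_edge_dist_le[OF assms(1,3) continuous_on_powr_greaterThan]) auto
  finally show ?thesis by simp
qed

lemma energy_moment_corner:
  assumes "\<gamma> > 0" "k > 0"
  shows "energy_moment 0 \<gamma> (- 3/2) (k powr (2 * \<gamma>))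
    \<le> (2 * 12 powr (- \<gamma>)) powr (- 3/2) * corner_integral (3 * \<gamma>) k"
proof -
  let ?s = "\<lambda>x. k + edge_dist (fst x) + edge_dist (snd x)"
  have h: "k powr (2 * \<gamma>) > 0" using assms by simp
  have le: "(2 * (k powr (2 * \<gamma>) + well 0 x powr \<gamma>)) powr (- 3/2)
      \<le> (2 * 12 powr (- \<gamma>)) powr (- 3/2) * ?s x powr (- (3 * \<gamma>))" if x: "x \<in> {0..1} \<times> {0..1}" for x
  proof -
    have s: "?s x > 0"
      using x edge_dist_range[of "fst x"] edge_dist_range[of "snd x"] assms(2) by auto
    have "(2 * (k powr (2 * \<gamma>) + well 0 x powr \<gamma>)) powr (- 3/2)
        \<le> (2 * (12 powr (- \<gamma>) * ?s x powr (2 * \<gamma>))) powr (- 3/2)"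
      using energy_ge[OF assms x] s by (intro powr_mono2') auto
    also have "\<dots> = (2 * 12 powr (- \<gamma>)) powr (- 3/2) * (?s x powr (2 * \<gamma>)) powr (- 3/2)"
      unfolding mult.assoc[symmetric] by (rule powr_mult)
    also have "(?s x powr (2 * \<gamma>)) powr (- 3/2) = ?s x powr (- (3 * \<gamma>))"
      by (simp add: powr_powr)
    finally show ?thesis .
  qed
  have "energy_moment 0 \<gamma> (- 3/2) (k powr (2 * \<gamma>))
    \<le> integral ({0..1} \<times> {0..1}) (\<lambda>x. (2 * 12 powr (- \<gamma>)) powr (- 3/2) * ?s x powr (- (3 * \<gamma>)))"
    unfolding energy_moment_def torus_integral_def
  proof (rule integral_le[OF integrable_on_torus[OF continuous_moment[OF assms(1) h]] _ le])
    show "(\<lambda>x. (2 * 12 powr (- \<gamma>)) powr (- 3/2) * ?s x powr (- (3 * \<gamma>))) integrable_on ({0..1} \<times> {0..1})"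
      using continuous_on_mult[OF continuous_on_const continuous_on_corner[OF assms(2)]]
      unfolding unit_square by (rule integrable_continuous)
  qed
  then show ?thesis by (simp add: corner_integral_def)
qed

section \<open>Bounds on the moments in the different regimes of \<gamma>\<close>

lemma powr_scale:
  fixes h \<gamma> :: real
  assumes "\<gamma> > 0" "h > 0"
  shows "(h powr (1 / (2 * \<gamma>))) powr (2 * \<gamma>) = h"
  using assms by (simp add: powr_powr)

text \<open>For \<open>3 * \<gamma> > 2\<close> the second primitive is a negative power, dominated
  by its value at \<open>k\<close>; the exponent in \<open>h\<close> is
  \<open>(2 - 3 * \<gamma>) / (2 * \<gamma>) = 1/\<gamma> - 3/2\<close>.\<close>

lemma energy_moment_supercritical:
  assumes "\<gamma> > 2/3"
  shows "\<exists>C\<ge>0. \<forall>h>0. energy_moment 0 \<gamma> (- 3/2) h \<le> C * h powr (1/\<gamma> - 3/2)"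
proof -
  define D where "D = (2 * 12 powr (- \<gamma>)) powr (- 3/2)"
  define C where "C = D * (4 / ((3 * \<gamma> - 1) * (3 * \<gamma> - 2)))"
  have "energy_moment 0 \<gamma> (- 3/2) h \<le> C * h powr (1/\<gamma> - 3/2)" if h: "h > 0" for h
  proof -
    define k where "k = h powr (1 / (2 * \<gamma>))"
    have k: "k > 0" "k powr (2 * \<gamma>) = h" using h assms powr_scale[of \<gamma> h] by (auto simp: k_def)
    let ?F = "\<lambda>s::real. s powr (1 - (3 * \<gamma> - 1)) / (1 - (3 * \<gamma> - 1))"
    have "corner_integral (3 * \<gamma>) k \<le> 4 / (3 * \<gamma> - 1) * (?F (k + 1) - ?F k)"
    proof (rule corner_integral_le[OF k(1)])
      show "(?F has_real_derivative s powr (1 - 3 * \<gamma>)) (at s)" if "s > 0" for s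
        using powr_antiderivative[of "3 * \<gamma> - 1" s] that assms by simp
    qed (use assms in auto)
    also have "?F (k + 1) - ?F k = (k powr (2 - 3 * \<gamma>) - (k + 1) powr (2 - 3 * \<gamma>)) / (3 * \<gamma> - 2)"
      unfolding divide_flip_diff by (simp add: algebra_simps)
    also have "4 / (3 * \<gamma> - 1) * \<dots> \<le> 4 / (3 * \<gamma> - 1) * (k powr (2 - 3 * \<gamma>) / (3 * \<gamma> - 2))"
      using assms by (intro mult_left_mono divide_right_mono) auto
    finally have "D * corner_integral (3 * \<gamma>) k \<le> D * (4 / (3 * \<gamma> - 1) * (k powr (2 - 3 * \<gamma>) / (3 * \<gamma> - 2)))"
      by (rule mult_left_mono) (simp add: D_def)
    also have "\<dots> = C * k powr (2 - 3 * \<gamma>)" by (simp add: C_def)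
    also have "k powr (2 - 3 * \<gamma>) = h powr (1/\<gamma> - 3/2)"
      using assms by (simp add: k_def powr_powr field_simps)
    finally show ?thesis
      using energy_moment_corner[of \<gamma> k] k assms by (simp add: D_def)
  qed
  moreover have "C \<ge> 0" using assms by (simp add: C_def D_def)
  ultimately show ?thesis by blast
qed

text \<open>Here \<open>b = 2\<close> and the second primitive is \<open>ln\<close>;
  \<open>h \<le> 1\<close> keeps \<open>ln (k + 1)\<close> bounded.\<close>

lemma energy_moment_critical:
  "\<exists>C\<ge>0. \<forall>h. 0 < h \<and> h \<le> 1 \<longrightarrow> energy_moment 0 (2/3) (- 3/2) h \<le> C * (1 + \<bar>ln h\<bar>)"
proof -
  define D where "D = (2 * 12 powr (- (2/3))) powr (- 3/2 :: real)"
  have "energy_moment 0 (2/3) (- 3/2) h \<le> 4 * D * (1 + \<bar>ln h\<bar>)" if h: "0 < h" "h \<le> 1" for h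
  proof -
    define k where "k = h powr (3/4)"
    have k: "0 < k" "k \<le> 1" "k powr (4/3) = h"
      using h powr_scale[of "2/3" h] by (auto simp: k_def powr_le1)
    have "corner_integral 2 k \<le> 4 / (2 - 1) * (ln (k + 1) - ln k)"
      by (rule corner_integral_le[OF k(1)])
        (auto simp: powr_minus_divide intro!: derivative_eq_intros)
    also have "ln (k + 1) \<le> 1" using k ln_le_minus_one[of "k + 1"] by simp
    also have "ln k = 3/4 * ln h" using h by (simp add: k_def ln_powr)
    also have "4 / (2 - 1) * (1 - 3/4 * ln h) \<le> 4 * (1 + \<bar>ln h\<bar>)" using h by simp
    finally have "corner_integral 2 k \<le> 4 * (1 + \<bar>ln h\<bar>)" by simp
    then have "D * corner_integral 2 k \<le> D * (4 * (1 + \<bar>ln h\<bar>))"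
      by (rule mult_left_mono) (simp add: D_def)
    moreover have "energy_moment 0 (2/3) (- 3/2) h \<le> D * corner_integral 2 k"
      using energy_moment_corner[of "2/3" k] k by (simp add: D_def)
    ultimately show ?thesis by (simp only: mult_ac)
  qed
  then show ?thesis by (intro exI[of _ "4 * D"]) (simp add: D_def)
qed

lemma energy_moment_subcritical:
  assumes "0 < \<gamma>" "\<gamma> < 2/3"
  shows "\<exists>C\<ge>0. \<forall>h. 0 < h \<and> h \<le> 1 \<longrightarrow> energy_moment 0 \<gamma> (- 3/2) h \<le> C"
proof -
  \<comment> \<open>The exponent must exceed \<open>1\<close> for \<open>corner_integral_le\<close>
    and stay below \<open>2\<close> for a bound uniform as \<open>k\<close> tends to
    \<open>0\<close>, so \<open>3 * \<gamma>\<close> is raised when it is too small.\<close>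
  define b where "b = max (3 * \<gamma>) (3/2)"
  have b: "1 < b" "b < 2" "3 * \<gamma> \<le> b" using assms by (auto simp: b_def)
  define D where "D = (2 * 12 powr (- \<gamma>)) powr (- 3/2)"
  define C where "C = D * (2 powr (b - 3 * \<gamma>) * (4 / (b - 1) * (2 powr (2 - b) / (2 - b))))"
  have "energy_moment 0 \<gamma> (- 3/2) h \<le> C" if h: "0 < h" "h \<le> 1" for h
  proof -
    define k where "k = h powr (1 / (2 * \<gamma>))"
    have k: "0 < k" "k \<le> 1" "k powr (2 * \<gamma>) = h"
      using h assms powr_scale[of \<gamma> h] by (auto simp: k_def powr_le1)
    let ?s = "\<lambda>x. k + edge_dist (fst x) + edge_dist (snd x)"
    have "corner_integral (3 * \<gamma>) k \<le> integral ({0..1} \<times> {0..1}) (\<lambda>x. 2 powr (b - 3 * \<gamma>) * ?s x powr (- b))"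
      unfolding corner_integral_def
    proof (rule integral_le)
      show "(\<lambda>x. ?s x powr (- (3 * \<gamma>))) integrable_on ({0..1} \<times> {0..1})"
        using continuous_on_corner[OF k(1)] unfolding unit_square by (rule integrable_continuous)
      show "(\<lambda>x. 2 powr (b - 3 * \<gamma>) * ?s x powr (- b)) integrable_on ({0..1} \<times> {0..1})"
        using continuous_on_mult[OF continuous_on_const continuous_on_corner[OF k(1)]]
        unfolding unit_square by (rule integrable_continuous)
      fix x :: "real \<times> real" assume "x \<in> {0..1} \<times> {0..1}"
      then have s: "0 < ?s x" "?s x \<le> 2"
        using edge_dist_range[of "fst x"] edge_dist_range[of "snd x"] k by auto
      \<comment> \<open>Raising the exponent costs a constant factor because the base is at most
        \<open>2\<close>.\<close>
      have "?s x powr (- (3 * \<gamma>)) = ?s x powr (b - 3 * \<gamma>) * ?s x powr (- b)"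
        by (simp flip: powr_add)
      also have "\<dots> \<le> 2 powr (b - 3 * \<gamma>) * ?s x powr (- b)"
        using s b by (intro mult_right_mono powr_mono2) auto
      finally show "?s x powr (- (3 * \<gamma>)) \<le> 2 powr (b - 3 * \<gamma>) * ?s x powr (- b)" .
    qed
    also have "\<dots> = 2 powr (b - 3 * \<gamma>) * corner_integral b k" by (simp add: corner_integral_def)
    also have "corner_integral b k \<le> 4 / (b - 1) * ((k + 1) powr (2 - b) / (2 - b) - k powr (2 - b) / (2 - b))"
    proof (rule corner_integral_le[OF k(1) b(1)])
      show "((\<lambda>s. s powr (2 - b) / (2 - b)) has_real_derivative s powr (1 - b)) (at s)" if "s > 0" for s
        using powr_antiderivative[of "b - 1" s] that b by simp
    qed
    also have "\<dots> \<le> 4 / (b - 1) * (2 powr (2 - b) / (2 - b) - 0)"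
      using b k by (intro mult_left_mono diff_mono divide_right_mono powr_mono2) auto
    finally have "D * corner_integral (3 * \<gamma>) k \<le> C"
      unfolding C_def by (intro mult_left_mono) (auto simp: D_def)
    then show ?thesis using energy_moment_corner[of \<gamma> k] k assms by (simp add: D_def)
  qed
  moreover have "C \<ge> 0" using b by (simp add: C_def D_def)
  ultimately show ?thesis by blast
qed

text \<open>On a square of side \<open>a\<close> at the zero of the potential the energy is at most
  a multiple of \<open>h\<close>; the area of the square supplies the factor
  \<open>h powr (1/\<gamma>)\<close>.\<close>

lemma energy_moment_lower:
  assumes "\<gamma> > 0" "R > 0"
  shows "\<exists>c>0. \<forall>h. 0 < h \<and> h \<le> R \<longrightarrow> c * h powr (1/\<gamma> - 1/2) \<le> energy_moment 0 \<gamma> (- 1/2) h"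
proof -
  define E where "E = 2 * (1 + 64 powr \<gamma> / R)"
  have E: "E > 0" using assms by (simp add: E_def add_pos_nonneg)
  define c where "c = E powr (- 1/2) / R powr (1/\<gamma>)"
  have "c * h powr (1/\<gamma> - 1/2) \<le> energy_moment 0 \<gamma> (- 1/2) h" if h: "0 < h" "h \<le> R" for h
  proof -
    \<comment> \<open>Dividing by \<open>R\<close> keeps the side at most \<open>1\<close>, so the
      square lies in the fundamental domain.\<close>
    define a where "a = (h / R) powr (1 / (2 * \<gamma>))"
    have a: "0 < a" "a \<le> 1" "a powr (2 * \<gamma>) = h / R"
      using h assms powr_scale[of \<gamma> "h / R"] by (auto simp: a_def powr_le1)
    let ?B = "cbox (0, 0) (a, a)"
    let ?f = "\<lambda>x. (2 * (h + well 0 x powr \<gamma>)) powr (- 1/2)"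
    have int: "?f integrable_on cbox (0, 0) (b, b)" for b
      by (rule integrable_continuous)
        (rule continuous_on_subset[OF continuous_moment[OF assms(1) h(1)]], simp)
    have f_ge: "(E * h) powr (- 1/2) \<le> ?f x" if "x \<in> ?B" for x
    proof -
      have x: "0 \<le> fst x" "fst x \<le> a" "0 \<le> snd x" "snd x \<le> a"
        using that by (auto simp: cbox_Pair_eq)
      have "well 0 x \<le> 32 * (fst x)\<^sup>2 + 32 * (snd x)\<^sup>2"
        using one_minus_cos_le[of "fst x"] one_minus_cos_le[of "snd x"] by (simp add: well_def)
      also have "\<dots> \<le> 32 * a\<^sup>2 + 32 * a\<^sup>2" using x by (intro add_mono mult_left_mono power_mono) auto
      finally have "well 0 x powr \<gamma> \<le> (64 * a\<^sup>2) powr \<gamma>"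
        using assms by (intro powr_mono2) (auto simp: well_range)
      also have "\<dots> = 64 powr \<gamma> * (h / R)"
        unfolding powr_mult using a by (simp add: powr_powr flip: powr_numeral)
      finally have "2 * (h + well 0 x powr \<gamma>) \<le> 2 * (h + 64 powr \<gamma> * (h / R))" by simp
      also have "\<dots> = E * h" by (simp add: E_def algebra_simps)
      finally have "2 * (h + well 0 x powr \<gamma>) \<le> E * h" .
      then show ?thesis using h(1) by (intro powr_mono2') (auto simp: add_pos_nonneg)
    qed
    have "a\<^sup>2 * (E * h) powr (- 1/2) = integral ?B (\<lambda>x. (E * h) powr (- 1/2))"
      using a by (simp add: content_Pair power2_eq_square)
    also have "\<dots> \<le> integral ?B ?f"
      by (rule integral_le[OF _ int f_ge]) auto
    also have "\<dots> \<le> energy_moment 0 \<gamma> (- 1/2) h"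
      unfolding energy_moment_def torus_integral_def unit_square
      by (rule integral_subset_le[OF _ int int]) (use a in \<open>auto simp: cbox_Pair_eq\<close>)
    also have "a\<^sup>2 * (E * h) powr (- 1/2) = c * h powr (1/\<gamma> - 1/2)"
    proof -
      have "a\<^sup>2 = (h / R) powr (1 / \<gamma>)"
        using a(1) by (simp add: a_def powr_powr flip: powr_numeral)
      also have "\<dots> = h powr (1/\<gamma>) / R powr (1/\<gamma>)" using h assms by (simp add: powr_divide)
      finally have "a\<^sup>2 = h powr (1/\<gamma>) / R powr (1/\<gamma>)" .
      moreover have "h powr (1/\<gamma> - 1/2) = h powr (1/\<gamma>) * h powr (- 1/2)" by (simp flip: powr_add)
      ultimately show ?thesis by (simp add: c_def powr_mult)
    qed
    finally show ?thesis .
  qed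
  moreover have "c > 0" using E assms by (simp add: c_def)
  ultimately show ?thesis by blast
qed

section \<open>The inverse of the energy function\<close>

text \<open>After division by \<open>b\<close> the two fractions lie in \<open>[0, 1]\<close>, where
  \<open>t \<le> t powr \<alpha>\<close>, and they add up to one.\<close>

lemma powr_diff_le:
  fixes a b \<alpha> :: real
  assumes "0 \<le> a" "a \<le> b" "0 < \<alpha>" "\<alpha> \<le> 1"
  shows "b powr \<alpha> - a powr \<alpha> \<le> (b - a) powr \<alpha>"
proof (cases "b = 0")
  case False
  then have b: "b > 0" using assms by simp
  have "a / b \<le> (a / b) powr \<alpha>" "(b - a) / b \<le> ((b - a) / b) powr \<alpha>"
    using powr_mono'[OF assms(4), of "a / b"] powr_mono'[OF assms(4), of "(b - a) / b"] assms b by auto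
  then have "a / b + (b - a) / b \<le> (a powr \<alpha> + (b - a) powr \<alpha>) / b powr \<alpha>"
    using assms b by (simp add: powr_divide add_divide_distrib)
  moreover have "a / b + (b - a) / b = 1" using b by (simp add: field_simps)
  ultimately show ?thesis using b by (simp add: pos_le_divide_eq)
qed (use assms in auto)

text \<open>Separates the calculus from the potential: \<open>Hbar\<close> enters only as the
  inverse of an increasing concave function \<open>G\<close>.\<close>

locale energy_level =
  fixes G g I Hbar Hbar' :: "real \<Rightarrow> real" and p0 :: real
  assumes G_0: "G 0 = p0"
    and G_continuous: "continuous_on {0..} G"
    and G_deriv: "\<And>h. h > 0 \<Longrightarrow> (G has_real_derivative g h) (at h)"
    and g_deriv: "\<And>h. h > 0 \<Longrightarrow> (g has_real_derivative - I h) (at h)"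
    and g_pos: "\<And>h. h > 0 \<Longrightarrow> g h > 0"
    and I_nonneg: "\<And>h. h > 0 \<Longrightarrow> I h \<ge> 0"
    and Hbar_nonneg: "\<And>p. p0 \<le> p \<Longrightarrow> Hbar p \<ge> 0"
    and G_Hbar: "\<And>p. p0 \<le> p \<Longrightarrow> G (Hbar p) = p"
    and Hbar'_def: "Hbar' = deriv_from p0 Hbar"
begin

section \<open>The inverse function and its right derivative at \<open>p0\<close>\<close>

lemma G_strict_mono:
  assumes "0 \<le> a" "a < b"
  shows "G a < G b"
proof (rule DERIV_pos_imp_increasing_open[OF assms(2)])
  show "\<exists>y. (G has_real_derivative y) (at x) \<and> y > 0" if "a < x" for x
    using that assms(1) by (intro exI[of _ "g x"] conjI G_deriv g_pos) auto
  show "continuous_on {a..b} G" using assms by (intro continuous_on_subset[OF G_continuous]) auto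
qed

lemma Hbar_strict_mono:
  assumes "p0 \<le> p" "p < q"
  shows "Hbar p < Hbar q"
proof (rule ccontr)
  assume "\<not> ?thesis"
  then have "G (Hbar q) \<le> G (Hbar p)"
    using G_strict_mono[of "Hbar q" "Hbar p"] Hbar_nonneg[of q] assms by fastforce
  then show False using G_Hbar[of p] G_Hbar[of q] assms by simp
qed

lemma Hbar_p0: "Hbar p0 = 0"
  using G_strict_mono[of 0 "Hbar p0"] Hbar_nonneg[of p0] G_Hbar[of p0] G_0 by fastforce

lemma Hbar_pos: "p0 < p \<Longrightarrow> 0 < Hbar p"
  using Hbar_strict_mono[of p0 p] Hbar_p0 by simp

lemma g_antimono:
  assumes "0 < a" "a \<le> b"
  shows "g b \<le> g a"
proof -
  have "- g a \<le> - g b"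
  proof (rule DERIV_nonneg_imp_nondecreasing[OF assms(2)])
    fix x assume "a \<le> x" "x \<le> b"
    then show "\<exists>y. ((\<lambda>x. - g x) has_real_derivative y) (at x) \<and> y \<ge> 0"
      using DERIV_minus[OF g_deriv[of x]] I_nonneg[of x] assms by force
  qed
  then show ?thesis by simp
qed

text \<open>As \<open>g\<close> decreases, \<open>G\<close> has slope at least
  \<open>g (Hbar R)\<close> up to the level \<open>Hbar R\<close>, so its inverse is Lipschitz
  there. Derivatives are used only between the two levels, which admits
  \<open>p = p0\<close>.\<close>

lemma Hbar_increment_le:
  assumes "p0 \<le> p" "p \<le> q" "q \<le> R" "p0 < R"
  shows "g (Hbar R) * (Hbar q - Hbar p) \<le> q - p"
proof -
  let ?f = "\<lambda>h. G h - g (Hbar R) * h"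
  have le: "Hbar p \<le> Hbar q" "Hbar q \<le> Hbar R" "0 \<le> Hbar p"
    using Hbar_strict_mono[of p q] Hbar_strict_mono[of q R] Hbar_nonneg[of p] assms by fastforce+
  have "?f (Hbar p) \<le> ?f (Hbar q)"
  proof (rule DERIV_nonneg_imp_increasing_open[OF le(1)])
    fix x assume x: "Hbar p < x" "x < Hbar q"
    then have "g (Hbar R) \<le> g x" using le by (intro g_antimono) auto
    moreover have "(?f has_real_derivative (g x - g (Hbar R) * 1)) (at x)"
      using x le by (intro DERIV_diff DERIV_cmult DERIV_ident G_deriv) auto
    ultimately show "\<exists>y. (?f has_real_derivative y) (at x) \<and> y \<ge> 0" by force
  next
    show "continuous_on {Hbar p..Hbar q} ?f"
      using le by (intro continuous_intros continuous_on_subset[OF G_continuous]) auto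
  qed
  then show ?thesis using G_Hbar[of p] G_Hbar[of q] assms by (simp add: algebra_simps)
qed

lemma Hbar_continuous:
  assumes "p0 < R"
  shows "continuous_on {p0..R} Hbar"
proof (rule lipschitz_on_continuous_on)
  have c: "g (Hbar R) > 0" using assms by (intro g_pos Hbar_pos)
  have *: "\<bar>Hbar p - Hbar q\<bar> \<le> 1 / g (Hbar R) * \<bar>p - q\<bar>" if "p0 \<le> p" "p \<le> q" "q \<le> R" for p q
  proof -
    have "Hbar p \<le> Hbar q" using Hbar_strict_mono[of p q] that by fastforce
    then show ?thesis using Hbar_increment_le[OF that assms] that c by (simp add: field_simps)
  qed
  show "(1 / g (Hbar R))-lipschitz_on {p0..R} Hbar"
  proof (rule lipschitz_onI)
    show "dist (Hbar p) (Hbar q) \<le> 1 / g (Hbar R) * dist p q" if "p \<in> {p0..R}" "q \<in> {p0..R}" for p q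
      using *[of p q] *[of q p] that unfolding dist_real_def by (metis abs_minus_commute atLeastAtMost_iff linear)
  qed (use c in simp)
qed

lemma Hbar_deriv:
  assumes "p0 < p"
  shows "(Hbar has_real_derivative 1 / g (Hbar p)) (at p)"
proof -
  have "p < p + 1" by simp
  have "isCont Hbar p"
    using continuous_on_interior[OF Hbar_continuous[of "p + 1"], of p] assms by (simp add: interior_atLeastAtMost_real)
  then have "(Hbar has_real_derivative inverse (g (Hbar p))) (at p)"
    using G_deriv[OF Hbar_pos[OF assms]] g_pos[OF Hbar_pos[OF assms]] G_Hbar
    by (intro DERIV_inverse_function[OF _ _ assms \<open>p < p + 1\<close>]) auto
  then show ?thesis by (simp add: inverse_eq_divide)
qed

lemma Hbar'_eq: "p0 < p \<Longrightarrow> Hbar' p = 1 / g (Hbar p)"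
  using DERIV_imp_deriv[OF Hbar_deriv] by (simp add: Hbar'_def deriv_from_def)

lemma Hbar'_mono:
  assumes "p0 < p" "p \<le> q"
  shows "Hbar' p \<le> Hbar' q"
proof -
  have "Hbar p \<le> Hbar q" using Hbar_strict_mono[of p q] assms by fastforce
  then show ?thesis
    using assms g_antimono[of "Hbar p" "Hbar q"] g_pos[of "Hbar q"] Hbar_pos[of p]
    by (simp add: Hbar'_eq frac_le)
qed

text \<open>By monotonicity the limit exists and is the infimum. By the mean value theorem the
  difference quotients at \<open>p0\<close> are values of \<open>Hbar'\<close> at intermediate
  points, so they share this limit.\<close>

lemma Hbar'_tendsto: "(Hbar' \<longlongrightarrow> Hbar' p0) (at_right p0)"
proof -
  define L where "L = Inf (Hbar' ` {p0<..})"
  have bdd: "bdd_below (Hbar' ` {p0<..})"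
    by (rule bdd_belowI[of _ 0]) (auto simp: Hbar'_eq g_pos Hbar_pos less_imp_le)
  have lim: "(Hbar' \<longlongrightarrow> L) (at_right p0)"
  proof (rule order_tendstoI)
    fix y assume "y < L"
    then have "y < Hbar' p" if "p0 < p" for p
      using cInf_lower[OF _ bdd, of "Hbar' p"] that unfolding L_def by auto
    then show "\<forall>\<^sub>F p in at_right p0. y < Hbar' p"
      by (rule eventually_mono[OF eventually_at_right_less])
  next
    fix y assume "L < y"
    then obtain q where q: "p0 < q" "Hbar' q < y"
      unfolding L_def by (subst (asm) cInf_less_iff[OF _ bdd]) auto
    have "\<forall>\<^sub>F p in at_right p0. p \<in> {p0<..<q}" by (rule eventually_at_right_real[OF q(1)])
    then show "\<forall>\<^sub>F p in at_right p0. Hbar' p < y"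
      by eventually_elim (auto intro: le_less_trans[OF Hbar'_mono q(2)])
  qed
  have "((\<lambda>q. (Hbar q - Hbar p0) / (q - p0)) \<longlongrightarrow> L) (at_right p0)"
  proof (rule tendstoI)
    fix e :: real assume "e > 0"
    then have "\<forall>\<^sub>F q in at_right p0. dist (Hbar' q) L < e" by (rule tendstoD[OF lim])
    then obtain b where b: "b > p0" "\<And>q. p0 < q \<Longrightarrow> q < b \<Longrightarrow> dist (Hbar' q) L < e"
      unfolding eventually_at_right_field by blast
    have "\<forall>\<^sub>F q in at_right p0. q \<in> {p0<..<b}" by (rule eventually_at_right_real[OF b(1)])
    then show "\<forall>\<^sub>F q in at_right p0. dist ((Hbar q - Hbar p0) / (q - p0)) L < e"
    proof eventually_elim
      case (elim q)
      then have q: "p0 < q" by simp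
      obtain z where z: "p0 < z" "z < q" "Hbar q - Hbar p0 = (q - p0) * (1 / g (Hbar z))"
        using MVT[OF q Hbar_continuous[OF q]] Hbar_deriv
        by (metis DERIV_unique real_differentiable_def)
      then have "(Hbar q - Hbar p0) / (q - p0) = Hbar' z" using q by (simp add: Hbar'_eq)
      then show ?case using b(2)[of z] z elim by simp
    qed
  qed
  then have "Hbar' p0 = L"
    unfolding Hbar'_def deriv_from_def by (auto intro!: tendsto_Lim)
  then show ?thesis using lim by simp
qed

lemma endpoint_bound:
  assumes "\<forall>\<^sub>F p in at_right p0. \<bar>Hbar' q - Hbar' p\<bar> \<le> D p" "(D \<longlongrightarrow> d) (at_right p0)"
  shows "\<bar>Hbar' q - Hbar' p0\<bar> \<le> d"
  by (rule tendsto_le[OF _ assms(2) _ assms(1)]) (auto intro!: tendsto_intros Hbar'_tendsto)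

section \<open>Increments of the derivative\<close>

text \<open>\<open>1 / g\<close> has derivative \<open>I / g\<^sup>2\<close>, so
  \<open>\<Phi> - 1 / g\<close> is nondecreasing once \<open>\<phi>\<close> dominates that quotient.
  The estimates below differ in the choice of \<open>\<Phi>\<close>.\<close>

lemma Hbar'_increment_le:
  assumes "0 < a" "a \<le> b"
    and "\<And>h. a \<le> h \<Longrightarrow> h \<le> b \<Longrightarrow> (\<Phi> has_real_derivative \<phi> h) (at h)"
    and "\<And>h. a \<le> h \<Longrightarrow> h \<le> b \<Longrightarrow> I h \<le> \<phi> h * (g h)\<^sup>2"
  shows "1 / g b - 1 / g a \<le> \<Phi> b - \<Phi> a"
proof -
  have "\<Phi> a - 1 / g a \<le> \<Phi> b - 1 / g b"
  proof (rule DERIV_nonneg_imp_nondecreasing[OF assms(2)])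
    fix x assume x: "a \<le> x" "x \<le> b"
    then have gx: "g x > 0" using assms(1) by (intro g_pos) simp
    have "((\<lambda>h. 1 / g h) has_real_derivative I x / (g x)\<^sup>2) (at x)"
      using gx x assms(1) by (auto intro!: derivative_eq_intros g_deriv simp: power2_eq_square)
    then have "((\<lambda>h. \<Phi> h - 1 / g h) has_real_derivative \<phi> x - I x / (g x)\<^sup>2) (at x)"
      by (intro DERIV_diff assms(3) x)
    moreover have "I x / (g x)\<^sup>2 \<le> \<phi> x"
      using assms(4)[OF x] gx by (simp add: pos_divide_le_eq)
    ultimately show "\<exists>y. ((\<lambda>h. \<Phi> h - 1 / g h) has_real_derivative y) (at x) \<and> y \<ge> 0" by force
  qed
  then show ?thesis by simp
qed

lemma Hbar'_holder:
  assumes "\<alpha> > 0" "p0 < R"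
    and inner: "\<And>p q. p0 < p \<Longrightarrow> p < q \<Longrightarrow> q \<le> R \<Longrightarrow> Hbar' q - Hbar' p \<le> C * (q - p) powr \<alpha>"
    and "p0 \<le> p" "p \<le> R" "p0 \<le> q" "q \<le> R"
  shows "\<bar>Hbar' q - Hbar' p\<bar> \<le> C * \<bar>q - p\<bar> powr \<alpha>"
proof -
  have *: "\<bar>Hbar' q - Hbar' p\<bar> \<le> C * (q - p) powr \<alpha>" if "p0 < p" "p < q" "q \<le> R" for p q
    using inner[OF that] Hbar'_mono[of p q] that by simp
  have "\<bar>Hbar' q - Hbar' p\<bar> \<le> C * (q - p) powr \<alpha>" if "p0 \<le> p" "p < q" "q \<le> R" for p q
  proof (cases "p = p0")
    case True
    have "\<bar>Hbar' q - Hbar' p0\<bar> \<le> C * (q - p0) powr \<alpha>"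
    proof (rule endpoint_bound)
      have "\<forall>\<^sub>F p in at_right p0. p \<in> {p0<..<q}" using that True by (intro eventually_at_right_real) simp
      then show "\<forall>\<^sub>F p in at_right p0. \<bar>Hbar' q - Hbar' p\<bar> \<le> C * (q - p) powr \<alpha>"
        by eventually_elim (use * that in auto)
      show "((\<lambda>p. C * (q - p) powr \<alpha>) \<longlongrightarrow> C * (q - p0) powr \<alpha>) (at_right p0)"
        using that True by (intro tendsto_intros) auto
    qed
    then show ?thesis using True by simp
  qed (use * that in auto)
  from this[of p q] this[of q p] show ?thesis
    using assms(4-) by (cases p q rule: linorder_cases) (auto simp: abs_minus_commute)
qed

text \<open>The choice is a multiple of \<open>h powr \<alpha>\<close>. Subadditivity of the power
  leaves the increment of \<open>Hbar\<close>, which its Lipschitz bound up to \<open>R\<close>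
  converts to the increment of the momentum.\<close>

lemma Hbar'_holder_of_power:
  assumes "0 < \<alpha>" "\<alpha> \<le> 1" "p0 < R" "0 \<le> K"
    and "\<And>h. 0 < h \<Longrightarrow> h \<le> Hbar R \<Longrightarrow> I h \<le> K * h powr (\<alpha> - 1) * (g h)\<^sup>2"
  shows "\<exists>C. \<forall>q p. p0 \<le> q \<and> q \<le> R \<and> p0 \<le> p \<and> p \<le> R \<longrightarrow>
    \<bar>Hbar' q - Hbar' p\<bar> \<le> C * \<bar>q - p\<bar> powr \<alpha>"
proof -
  define C where "C = K / \<alpha> * (1 / g (Hbar R)) powr \<alpha>"
  have gR: "g (Hbar R) > 0" using assms by (intro g_pos Hbar_pos)
  have "Hbar' q - Hbar' p \<le> C * (q - p) powr \<alpha>" if pq: "p0 < p" "p < q" "q \<le> R" for p q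
  proof -
    have H: "0 < Hbar p" "Hbar p < Hbar q" "Hbar q \<le> Hbar R"
      using Hbar_pos[of p] Hbar_strict_mono[of p q] Hbar_strict_mono[of q R] pq by fastforce+
    have "1 / g (Hbar q) - 1 / g (Hbar p) \<le> K / \<alpha> * Hbar q powr \<alpha> - K / \<alpha> * Hbar p powr \<alpha>"
    proof (rule Hbar'_increment_le[where \<phi> = "\<lambda>h. K * h powr (\<alpha> - 1)"])
      fix h assume h: "Hbar p \<le> h" "h \<le> Hbar q"
      show "((\<lambda>h. K / \<alpha> * h powr \<alpha>) has_real_derivative K * h powr (\<alpha> - 1)) (at h)"
        using h H assms(1) by (auto intro!: derivative_eq_intros simp: powr_diff)
      show "I h \<le> K * h powr (\<alpha> - 1) * (g h)\<^sup>2" using h H by (intro assms(5)) auto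
    qed (use H in auto)
    also have "\<dots> = K / \<alpha> * (Hbar q powr \<alpha> - Hbar p powr \<alpha>)" by (simp add: algebra_simps)
    also have "\<dots> \<le> K / \<alpha> * (Hbar q - Hbar p) powr \<alpha>"
      using H assms by (intro mult_left_mono powr_diff_le) auto
    also have "\<dots> \<le> K / \<alpha> * ((1 / g (Hbar R)) * (q - p)) powr \<alpha>"
      using Hbar_increment_le[of p q R] H gR pq assms
      by (intro mult_left_mono powr_mono2) (auto simp: field_simps)
    also have "\<dots> = C * (q - p) powr \<alpha>"
      using gR pq unfolding C_def by (subst powr_mult) auto
    finally show ?thesis using pq by (simp add: Hbar'_eq)
  qed
  then show ?thesis using Hbar'_holder[OF assms(1,3), of C] by blast
qed

text \<open>The choice is a multiple of \<open>ln\<close>. The level vanishes at \<open>p0\<close>,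
  where the logarithm diverges, so both momenta stay above \<open>p0\<close>.\<close>

lemma Hbar'_log:
  assumes "p0 < R" "0 \<le> K" "\<And>h. 0 < h \<Longrightarrow> h \<le> Hbar R \<Longrightarrow> I h \<le> K * (1 / h) * (g h)\<^sup>2"
  shows "\<exists>C. \<forall>q p. p0 < q \<and> q \<le> R \<and> p0 < p \<and> p \<le> R \<longrightarrow>
    \<bar>Hbar' q - Hbar' p\<bar> \<le> C * \<bar>ln (Hbar q) - ln (Hbar p)\<bar>"
proof -
  have *: "\<bar>Hbar' q - Hbar' p\<bar> \<le> K * \<bar>ln (Hbar q) - ln (Hbar p)\<bar>" if pq: "p0 < p" "p < q" "q \<le> R" for p q
  proof -
    have H: "0 < Hbar p" "Hbar p < Hbar q" "Hbar q \<le> Hbar R"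
      using Hbar_pos[of p] Hbar_strict_mono[of p q] Hbar_strict_mono[of q R] pq by fastforce+
    have "1 / g (Hbar q) - 1 / g (Hbar p) \<le> K * ln (Hbar q) - K * ln (Hbar p)"
    proof (rule Hbar'_increment_le[where \<phi> = "\<lambda>h. K * (1 / h)"])
      fix h assume h: "Hbar p \<le> h" "h \<le> Hbar q"
      show "((\<lambda>h. K * ln h) has_real_derivative K * (1 / h)) (at h)"
        using h H by (auto intro!: derivative_eq_intros)
      show "I h \<le> K * (1 / h) * (g h)\<^sup>2" using h H by (intro assms(3)) auto
    qed (use H in auto)
    moreover have "ln (Hbar p) \<le> ln (Hbar q)" using H by simp
    ultimately show ?thesis using Hbar'_mono[of p q] pq by (simp add: Hbar'_eq algebra_simps)
  qed
  have "\<bar>Hbar' q - Hbar' p\<bar> \<le> K * \<bar>ln (Hbar q) - ln (Hbar p)\<bar>"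
    if "p0 < q" "q \<le> R" "p0 < p" "p \<le> R" for p q
    using *[of p q] *[of q p] that
    by (cases p q rule: linorder_cases) (auto simp: abs_minus_commute)
  then show ?thesis by blast
qed

text \<open>The choice \<open>K * G\<close> measures increments by the momentum itself, as
  \<open>G (Hbar p) = p\<close>; this makes one constant valid on the whole half-line.\<close>

lemma Hbar'_lipschitz:
  assumes "\<And>h. 0 < h \<Longrightarrow> I h \<le> K * (g h) ^ 3"
  shows "\<exists>C. \<forall>q p. p0 \<le> q \<and> p0 \<le> p \<longrightarrow> \<bar>Hbar' q - Hbar' p\<bar> \<le> C * \<bar>q - p\<bar>"
proof -
  have inner: "Hbar' q - Hbar' p \<le> K * (q - p) powr 1" if pq: "p0 < p" "p < q" for p q
  proof -
    have H: "0 < Hbar p" "Hbar p < Hbar q"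
      using Hbar_pos[of p] Hbar_strict_mono[of p q] pq by auto
    have "1 / g (Hbar q) - 1 / g (Hbar p) \<le> K * G (Hbar q) - K * G (Hbar p)"
    proof (rule Hbar'_increment_le[where \<phi> = "\<lambda>h. K * g h"])
      fix h assume h: "Hbar p \<le> h" "h \<le> Hbar q"
      show "((\<lambda>h. K * G h) has_real_derivative K * g h) (at h)"
        using h H by (intro DERIV_cmult G_deriv) auto
      show "I h \<le> K * g h * (g h)\<^sup>2"
        using h H assms[of h] by (auto simp: power3_eq_cube power2_eq_square mult.assoc)
    qed (use H in auto)
    then show ?thesis using pq by (simp add: Hbar'_eq G_Hbar algebra_simps)
  qed
  have "\<bar>Hbar' q - Hbar' p\<bar> \<le> K * \<bar>q - p\<bar> powr 1" if "p0 \<le> q" "p0 \<le> p" for p q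
    by (rule Hbar'_holder[of 1 "max p q + 1"]) (use inner that in auto)
  then show ?thesis by (auto intro!: exI[of _ K])
qed

text \<open>The weight \<open>h (1 + \<bar>ln h\<bar>)\<close> is increasing with derivative \<open>- ln h\<close> on \<open>(0,1)\<close> and \<open>2 + ln h\<close>
  on \<open>(1,\<infinity>)\<close>. It degenerates on the left of \<open>1\<close>, so the increment of \<open>1 / g\<close> over the excluded
  window \<open>(1 - \<eta>, 1)\<close> is compared with the total increment of the weight over that window.\<close>

lemma Hbar'_log_weight:
  assumes "\<eta> > 0" "0 \<le> K"
    and small: "\<And>h. 0 < h \<Longrightarrow> h \<le> 1 \<Longrightarrow> I h \<le> K * (1 + \<bar>ln h\<bar>) * (g h)\<^sup>2"
    and large: "\<And>h. 1 \<le> h \<Longrightarrow> I h \<le> K * (g h)\<^sup>2"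
  shows "\<exists>C. \<forall>q p. p0 \<le> q \<and> p0 \<le> p \<and> Hbar q \<notin> {1 - \<eta><..<1} \<and> Hbar p \<notin> {1 - \<eta><..<1} \<longrightarrow>
    \<bar>Hbar' q - Hbar' p\<bar> \<le> C * \<bar>Hbar q * (1 + \<bar>ln (Hbar q)\<bar>) - Hbar p * (1 + \<bar>ln (Hbar p)\<bar>)\<bar>"
proof -
  define \<Phi> where "\<Phi> h = h * (1 + \<bar>ln h\<bar>)" for h :: real
  \<comment> \<open>The minimum keeps \<open>\<tau>\<close> positive when \<open>\<eta>\<close> is
    large.\<close>
  define \<tau> where "\<tau> = 1 - min \<eta> (1/2)"
  have \<tau>: "0 < \<tau>" "\<tau> < 1" "1 - \<eta> \<le> \<tau>" using assms(1) by (auto simp: \<tau>_def min_def)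
  define m where "m = - ln \<tau>"
  have m: "m > 0" using \<tau> by (simp add: m_def)
  define F where "F h = 1 / g h" for h
  \<comment> \<open>Below \<open>\<tau>\<close> one has \<open>- ln h \<ge> m\<close>, so
    \<open>1 + \<bar>ln h\<bar>\<close> is at most \<open>(1 / m + 1) * (- ln h)\<close>, a multiple
    of the slope of the weight.\<close>
  define A where "A = K * (1 / m + 1)"
  have A: "A \<ge> K" "A \<ge> 0" using assms(2) m by (auto simp: A_def mult_le_cancel_left1)
  have below: "F b - F a \<le> A * (\<Phi> b - \<Phi> a)" if ab: "0 < a" "a \<le> b" "b \<le> \<tau>" for a b
  proof -
    have "F b - F a \<le> A * (b - b * ln b) - A * (a - a * ln a)"
      unfolding F_def
    proof (rule Hbar'_increment_le[where \<phi> = "\<lambda>h. A * (- ln h)"])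
      fix h assume h: "a \<le> h" "h \<le> b"
      then have h0: "0 < h" "h \<le> \<tau>" using ab by auto
      show "((\<lambda>h. A * (h - h * ln h)) has_real_derivative A * - ln h) (at h)"
        using h0 by (auto intro!: derivative_eq_intros)
      have l: "m \<le> - ln h" using h0 \<tau> by (simp add: m_def)
      have "1 + \<bar>ln h\<bar> \<le> (1 / m + 1) * (- ln h)"
        using l m by (simp add: field_simps)
      then have "K * (1 + \<bar>ln h\<bar>) \<le> A * (- ln h)"
        unfolding A_def mult.assoc using assms(2) by (rule mult_left_mono)
      then show "I h \<le> A * - ln h * (g h)\<^sup>2"
        using small[of h] h0 \<tau> by (meson less_imp_le mult_right_mono order_trans zero_le_power2)
    qed (use ab in auto)
    moreover have "\<Phi> a = a - a * ln a" "\<Phi> b = b - b * ln b"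
      using ab \<tau> by (simp_all add: \<Phi>_def algebra_simps)
    ultimately show ?thesis by (simp only: right_diff_distrib)
  qed
  have above: "F b - F a \<le> A * (\<Phi> b - \<Phi> a)" if ab: "1 \<le> a" "a \<le> b" for a b
  proof -
    have "F b - F a \<le> A * (b + b * ln b) - A * (a + a * ln a)"
      unfolding F_def
    proof (rule Hbar'_increment_le[where \<phi> = "\<lambda>h. A * (2 + ln h)"])
      fix h assume h: "a \<le> h" "h \<le> b"
      then have h0: "1 \<le> h" using ab by auto
      show "((\<lambda>h. A * (h + h * ln h)) has_real_derivative A * (2 + ln h)) (at h)"
        using h0 by (auto intro!: derivative_eq_intros)
      have "K * 1 \<le> A * (2 + ln h)" using h0 A assms(2) by (intro mult_mono) auto
      then show "I h \<le> A * (2 + ln h) * (g h)\<^sup>2"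
        using large[OF h0] mult_right_mono[of K "A * (2 + ln h)" "(g h)\<^sup>2"] by simp
    qed (use ab in auto)
    moreover have "\<Phi> a = a + a * ln a" "\<Phi> b = b + b * ln b"
      using ab by (simp_all add: \<Phi>_def algebra_simps)
    ultimately show ?thesis by (simp only: right_diff_distrib)
  qed
  have \<Phi>_mono_below: "\<Phi> a \<le> \<Phi> b" if "0 \<le> a" "a \<le> b" "b \<le> 1" for a b
  proof (cases "a = 0")
    case False
    have "a - a * ln a \<le> b - b * ln b"
    proof (rule DERIV_nonneg_imp_nondecreasing[OF that(2)])
      fix h assume "a \<le> h" "h \<le> b"
      then have h: "0 < h" "h \<le> 1" using that False by auto
      then have "((\<lambda>h. h - h * ln h) has_real_derivative - ln h) (at h)"
        by (auto intro!: derivative_eq_intros)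
      then show "\<exists>y. ((\<lambda>h. h - h * ln h) has_real_derivative y) (at h) \<and> y \<ge> 0"
        using h by (intro exI[of _ "- ln h"]) auto
    qed
    then show ?thesis using that False by (simp add: \<Phi>_def algebra_simps)
  qed (use that in \<open>simp add: \<Phi>_def\<close>)
  have \<Phi>_mono_above: "\<Phi> a \<le> \<Phi> b" if "1 \<le> a" "a \<le> b" for a b
    unfolding \<Phi>_def using that by (intro mult_mono) auto
  have gap: "\<Phi> \<tau> < \<Phi> 1"
  proof -
    have "ln (1 / \<tau>) < 1 / \<tau> - 1"
      using ln_le_minus_one[of "1 / \<tau>"] ln_eq_minus_one[of "1 / \<tau>"] \<tau> by fastforce
    then have "\<tau> * (1 - ln \<tau>) < \<tau> * (1 / \<tau>)"
      using \<tau> by (intro mult_strict_left_mono) (simp_all add: ln_div)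
    then show ?thesis using \<tau> by (simp add: \<Phi>_def)
  qed
  \<comment> \<open>The second entry is the ratio of the total increments over the window; its
    denominator is positive by \<open>gap\<close>.\<close>
  define C where "C = max A ((F 1 - F \<tau>) / (\<Phi> 1 - \<Phi> \<tau>))"
  have C: "A \<le> C" "0 \<le> C" using A by (auto simp: C_def)
  have across: "F 1 - F \<tau> \<le> C * (\<Phi> 1 - \<Phi> \<tau>)"
    using gap by (simp add: C_def flip: pos_divide_le_eq)
  have scale: "x \<le> C * y" if "x \<le> A * y" "0 \<le> y" for x y
    using that C(1) by (meson mult_right_mono order_trans)
  have F_le: "F b - F a \<le> C * (\<Phi> b - \<Phi> a)"
    if ab: "0 < a" "a \<le> b" "a \<le> \<tau> \<or> 1 \<le> a" "b \<le> \<tau> \<or> 1 \<le> b" for a b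
  proof -
    consider "b \<le> \<tau>" | "1 \<le> a" | "a \<le> \<tau>" "1 \<le> b" using ab by blast
    then show ?thesis
    proof cases
      case 1
      then show ?thesis using ab \<tau> by (intro scale below) (auto simp: \<Phi>_mono_below)
    next
      case 2
      then show ?thesis using ab by (intro scale above) (auto simp: \<Phi>_mono_above)
    next
      case 3
      have "F b - F 1 \<le> C * (\<Phi> b - \<Phi> 1)"
        using 3 by (intro scale above) (auto simp: \<Phi>_mono_above)
      moreover have "F \<tau> - F a \<le> C * (\<Phi> \<tau> - \<Phi> a)"
        using 3 ab \<tau> by (intro scale below) (auto simp: \<Phi>_mono_below)
      ultimately show ?thesis using across unfolding right_diff_distrib by linarith
    qed
  qed
  let ?ok = "\<lambda>h. h \<le> \<tau> \<or> 1 \<le> h"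
  have interior: "\<bar>Hbar' q - Hbar' p\<bar> \<le> C * (\<Phi> (Hbar q) - \<Phi> (Hbar p))"
    if "p0 < p" "p < q" "?ok (Hbar p)" "?ok (Hbar q)" for p q
    using F_le[of "Hbar p" "Hbar q"] Hbar_pos[of p] Hbar_strict_mono[of p q] Hbar'_mono[of p q] that
    by (simp add: Hbar'_eq F_def)
  have ordered: "\<bar>Hbar' q - Hbar' p\<bar> \<le> C * \<bar>\<Phi> (Hbar q) - \<Phi> (Hbar p)\<bar>"
    if pq: "p0 \<le> p" "p < q" "?ok (Hbar p)" "?ok (Hbar q)" for p q
  proof (cases "p = p0")
    case True
    have q: "p0 < q" using pq True by simp
    have "(Hbar \<longlongrightarrow> Hbar p0) (at p0 within {p0..q})"
      using Hbar_continuous[OF q] q by (simp add: continuous_on)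
    then have "(Hbar \<longlongrightarrow> 0) (at_right p0)"
      using q by (simp add: Hbar_p0 at_within_Icc_at_right)
    then have "\<forall>\<^sub>F p in at_right p0. Hbar p < \<tau>" using \<tau>(1) by (rule order_tendstoD)
    moreover have "\<forall>\<^sub>F p in at_right p0. p \<in> {p0<..<q}" by (rule eventually_at_right_real[OF q])
    \<comment> \<open>The weight vanishes at level \<open>0\<close>, so dropping
      \<open>\<Phi> (Hbar p)\<close> loses nothing in the limit and leaves a bound independent of
      \<open>p\<close>.\<close>
    ultimately have "\<forall>\<^sub>F p in at_right p0. \<bar>Hbar' q - Hbar' p\<bar> \<le> C * \<Phi> (Hbar q)"
    proof eventually_elim
      case (elim p)
      then have "0 \<le> \<Phi> (Hbar p)" using Hbar_pos[of p] by (simp add: \<Phi>_def)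
      then have "C * (\<Phi> (Hbar q) - \<Phi> (Hbar p)) \<le> C * \<Phi> (Hbar q)" using C by (simp add: mult_left_mono)
      then show ?case using interior[of p q] elim pq by force
    qed
    then have "\<bar>Hbar' q - Hbar' p0\<bar> \<le> C * \<Phi> (Hbar q)" by (rule endpoint_bound) simp
    moreover have "0 \<le> \<Phi> (Hbar q)" using Hbar_pos[OF q] by (simp add: \<Phi>_def)
    ultimately show ?thesis using True by (simp add: Hbar_p0 \<Phi>_def)
  next
    case False
    then have "\<bar>Hbar' q - Hbar' p\<bar> \<le> C * (\<Phi> (Hbar q) - \<Phi> (Hbar p))" using pq by (intro interior) auto
    also have "\<dots> \<le> C * \<bar>\<Phi> (Hbar q) - \<Phi> (Hbar p)\<bar>" using C by (intro mult_left_mono) auto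
    finally show ?thesis .
  qed
  have "\<bar>Hbar' q - Hbar' p\<bar> \<le> C * \<bar>\<Phi> (Hbar q) - \<Phi> (Hbar p)\<bar>"
    if "p0 \<le> q" "p0 \<le> p" "Hbar q \<notin> {1 - \<eta><..<1}" "Hbar p \<notin> {1 - \<eta><..<1}" for p q
  proof -
    have "?ok (Hbar p)" "?ok (Hbar q)" using that(3,4) \<tau>(3) by auto
    then show ?thesis using ordered[of p q] ordered[of q p] that
      by (cases p q rule: linorder_cases) (auto simp: abs_minus_commute)
  qed
  then show ?thesis unfolding \<Phi>_def by blast
qed

end

section \<open>Regularity of the effective Hamiltonian\<close>

text \<open>For \<open>h \<ge> 1\<close> all energies are comparable with \<open>h\<close>, so the
  moments have sizes \<open>h powr (- 3/2)\<close> and \<open>h powr (- 1/2)\<close>. The cubic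
  comparison matches these powers; the quadratic one gives some away using
  \<open>2 * h \<ge> 1\<close>. They serve the estimates with no upper bound on the momenta.\<close>

lemma energy_moment_ratio_bounds:
  assumes "\<gamma> > 0" "h \<ge> 1"
  defines "A \<equiv> 1 + 4 powr \<gamma>"
  shows "energy_moment \<theta> \<gamma> (- 3/2) h \<le> A * (energy_moment \<theta> \<gamma> (- 1/2) h)\<^sup>2"
    and "energy_moment \<theta> \<gamma> (- 3/2) h \<le> A powr (3/2) * energy_moment \<theta> \<gamma> (- 1/2) h ^ 3"
proof -
  let ?I = "energy_moment \<theta> \<gamma> (- 3/2) h" and ?g = "energy_moment \<theta> \<gamma> (- 1/2) h"
  have A: "A > 0" by (simp add: A_def add_pos_nonneg)
  define x where "x = 2 * h * A"
  have x: "x > 0" using assms(2) A by (simp add: x_def)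
  have "h + 4 powr \<gamma> \<le> h * A"
    using assms(2) mult_right_mono[of 1 h "4 powr \<gamma>"] by (simp add: A_def distrib_left)
  then have "x powr (- 1/2) \<le> (2 * (h + 4 powr \<gamma>)) powr (- 1/2)"
    using assms(2) by (intro powr_mono2') (auto simp: x_def add_pos_nonneg)
  also have "\<dots> \<le> ?g" using energy_moment_bounds(2)[OF assms(1), of h "- 1/2"] assms(2) by simp
  finally have g: "x powr (- 1/2) \<le> ?g" .
  have I: "?I \<le> (2 * h) powr (- 3/2)"
    using energy_moment_bounds(1)[OF assms(1), of h "- 3/2"] assms(2) by simp
  have "?I \<le> (2 * h) powr (- 1)" using I by (rule order_trans) (use assms(2) in \<open>intro powr_mono; simp\<close>)
  also have "\<dots> = A * (x powr (- 1/2))\<^sup>2"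
  proof -
    have "(x powr (- 1/2))\<^sup>2 = x powr (- 1)" using x by (simp add: powr_power)
    then show ?thesis using A assms(2) by (simp add: powr_minus_divide x_def)
  qed
  also have "\<dots> \<le> A * ?g\<^sup>2" using g A by (intro mult_left_mono power_mono) auto
  finally show "?I \<le> A * ?g\<^sup>2" .
  have "(2 * h) powr (- 3/2) = A powr (3/2) * (x powr (- 1/2)) ^ 3"
  proof -
    have "(x powr (- 1/2)) ^ 3 = x powr (- 3/2)" using x by (simp add: powr_powr flip: powr_numeral)
    also have "\<dots> = (2 * h) powr (- 3/2) * A powr (- 3/2)" unfolding x_def by (rule powr_mult)
    finally show ?thesis using A by (simp flip: powr_add)
  qed
  also have "\<dots> \<le> A powr (3/2) * ?g ^ 3" using g by (intro mult_left_mono power_mono) auto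
  finally show "?I \<le> A powr (3/2) * ?g ^ 3" using I by simp
qed

lemma sin_potential_eq: "sin_potential \<gamma> = (\<lambda>x. well (- (pi / 2)) x powr \<gamma>)"
  by (auto simp: sin_potential_def well_def fun_eq_iff cos_diff)

lemma cos_potential_eq: "cos_potential \<gamma> = (\<lambda>x. well 0 x powr \<gamma>)"
  by (auto simp: cos_potential_def well_def fun_eq_iff)

lemma effective_hamiltonian_energy:
  assumes "\<gamma> > 0" "non_resonant \<xi>" "h \<ge> 0"
  shows "effective_hamiltonian (\<lambda>x p. 1/2 * \<bar>p\<bar>\<^sup>2 - well \<theta> (x *\<^sub>R \<xi>) powr \<gamma>)
    (energy_moment \<theta> \<gamma> (1/2) h) = h"
proof (rule effective_hamiltonian_eqI)
  fix \<delta> :: real assume "\<delta> > 0"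
  then show "\<exists>W W'. smooth_corrector (\<lambda>x. well \<theta> (x *\<^sub>R \<xi>) powr \<gamma>) (energy_moment \<theta> \<gamma> (1/2) h) h \<delta> W W'"
    by (intro smooth_corrector_exists[where u = "\<lambda>t. t powr \<gamma>"] assms energy_moment_half
        continuous_on_subset[OF continuous_on_powr_pos]) (use assms in auto)
qed

text \<open>Every \<open>p \<ge> p0\<close> is the value of the moment at some level, and uniqueness
  of the level identifies that level with \<open>Hbar p\<close>.\<close>

lemma energy_level_well:
  assumes "\<gamma> > 0" "non_resonant \<xi>"
    and "Hbar = effective_hamiltonian (\<lambda>x p. 1/2 * \<bar>p\<bar>\<^sup>2 - well \<theta> (x *\<^sub>R \<xi>) powr \<gamma>)"
    and "p0 = energy_moment \<theta> \<gamma> (1/2) 0" "Hbar' = deriv_from p0 Hbar"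
  shows "energy_level (energy_moment \<theta> \<gamma> (1/2)) (energy_moment \<theta> \<gamma> (- 1/2))
    (energy_moment \<theta> \<gamma> (- 3/2)) Hbar Hbar' p0"
proof
  have Hbar: "Hbar p \<ge> 0 \<and> energy_moment \<theta> \<gamma> (1/2) (Hbar p) = p" if p: "p0 \<le> p" for p
  proof -
    obtain h where h: "h \<ge> 0" "energy_moment \<theta> \<gamma> (1/2) h = p"
      using energy_moment_surj[OF assms(1), of \<theta> p] p assms(4) by auto
    then have "Hbar p = h" using effective_hamiltonian_energy[OF assms(1,2) h(1), of \<theta>] assms(3) by simp
    then show ?thesis using h by simp
  qed
  then show "Hbar p \<ge> 0" "energy_moment \<theta> \<gamma> (1/2) (Hbar p) = p" if "p0 \<le> p" for p
    using that by blast+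
  show "continuous_on {0..} (energy_moment \<theta> \<gamma> (1/2))"
    by (rule energy_moment_continuous[OF assms(1)])
  fix h :: real assume h: "h > 0"
  show "(energy_moment \<theta> \<gamma> (1/2) has_real_derivative energy_moment \<theta> \<gamma> (- 1/2) h) (at h)"
    using energy_moment_deriv[OF assms(1) h, of \<theta> "1/2"] by simp
  show "(energy_moment \<theta> \<gamma> (- 1/2) has_real_derivative - energy_moment \<theta> \<gamma> (- 3/2) h) (at h)"
    using energy_moment_deriv[OF assms(1) h, of \<theta> "- 1/2"] by simp
  have pos: "energy_moment \<theta> \<gamma> s h > 0" if "s \<le> 0" for s
    by (rule less_le_trans[OF _ energy_moment_bounds(2)[OF assms(1) h that]])
      (use add_pos_nonneg[of "2 * h" "2 * 4 powr \<gamma>"] h in simp)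
  show "energy_moment \<theta> \<gamma> (- 1/2) h > 0" "energy_moment \<theta> \<gamma> (- 3/2) h \<ge> 0"
    using pos[of "- 1/2"] pos[of "- 3/2"] by simp_all
qed (use assms in simp_all)

text \<open>\<open>Hbar'\<close> grows linearly at infinity, so with an exponent below one or a
  logarithm the constant has to depend on a bound \<open>R\<close> for the momenta. For
  \<open>\<gamma> = 2/3\<close> the slope of the weight tends to \<open>0\<close> on the left of
  level \<open>1\<close> while that of \<open>1 / g\<close> does not, which accounts for the window
  of width \<open>\<eta>\<close>.\<close>

theorem lemma4p5:
  fixes \<gamma> p0 :: real and U :: "real \<times> real \<Rightarrow> real" and \<xi> :: "real \<times> real"
    and H :: "real \<Rightarrow> real \<Rightarrow> real" and Hbar Hbar' :: "real \<Rightarrow> real"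
  assumes "\<gamma> > 0"
    and "U = sin_potential \<gamma> \<or> U = cos_potential \<gamma>"
    and "non_resonant \<xi>"
    and "H = (\<lambda>x p. 1/2 * \<bar>p\<bar>\<^sup>2 - U (x *\<^sub>R \<xi>))"
    and "Hbar = effective_hamiltonian H"
    and "p0 = torus_integral (\<lambda>x. (2 * U x) powr (1/2))"
    and "Hbar' = deriv_from p0 Hbar"
  shows
    "(2 < \<gamma> \<longrightarrow> (\<forall>R. \<exists>C. \<forall>q p. p0 \<le> q \<and> q \<le> R \<and> p0 \<le> p \<and> p \<le> R \<longrightarrow>
        \<bar>Hbar' q - Hbar' p\<bar> \<le> C * \<bar>q - p\<bar> powr (1/2 - 1/\<gamma>))) \<and>
     (\<gamma> = 2 \<longrightarrow> (\<forall>R. \<exists>C. \<forall>q p. p0 < q \<and> q \<le> R \<and> p0 < p \<and> p \<le> R \<longrightarrow>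
        \<bar>Hbar' q - Hbar' p\<bar> \<le> C * \<bar>ln (Hbar q) - ln (Hbar p)\<bar>)) \<and>
     (2/3 < \<gamma> \<and> \<gamma> < 2 \<longrightarrow> (\<forall>R. \<exists>C. \<forall>q p. p0 \<le> q \<and> q \<le> R \<and> p0 \<le> p \<and> p \<le> R \<longrightarrow>
        \<bar>Hbar' q - Hbar' p\<bar> \<le> C * \<bar>q - p\<bar> powr (1/\<gamma> - 1/2))) \<and>
     (\<gamma> = 2/3 \<longrightarrow> (\<forall>\<eta>>0. \<exists>C. \<forall>q p. p0 \<le> q \<and> p0 \<le> p \<and>
          Hbar q \<notin> {1 - \<eta><..<1} \<and> Hbar p \<notin> {1 - \<eta><..<1} \<longrightarrow>
        \<bar>Hbar' q - Hbar' p\<bar>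
          \<le> C * \<bar>Hbar q * (1 + \<bar>ln (Hbar q)\<bar>) - Hbar p * (1 + \<bar>ln (Hbar p)\<bar>)\<bar>)) \<and>
     (\<gamma> < 2/3 \<longrightarrow> (\<exists>C. \<forall>q p. p0 \<le> q \<and> p0 \<le> p \<longrightarrow>
        \<bar>Hbar' q - Hbar' p\<bar> \<le> C * \<bar>q - p\<bar>))"
proof -
  obtain \<theta> where \<theta>: "\<theta> = 0 \<or> \<theta> = - (pi / 2)" and U: "U = (\<lambda>x. well \<theta> x powr \<gamma>)"
    using assms(2) sin_potential_eq cos_potential_eq by blast
  define G g I where "G = energy_moment \<theta> \<gamma> (1/2)" and "g = energy_moment \<theta> \<gamma> (- 1/2)"
    and "I = energy_moment \<theta> \<gamma> (- 3/2)"
  have p0: "p0 = energy_moment \<theta> \<gamma> (1/2) 0"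
    unfolding assms(6) U by (simp add: energy_moment_def)
  interpret energy_level G g I Hbar Hbar' p0
    unfolding G_def g_def I_def
    by (rule energy_level_well[OF assms(1,3) _ p0 assms(7)]) (simp only: assms(5,4) U)
  \<comment> \<open>Translation invariance reduces both potentials to phase
    \<open>0\<close>.\<close>
  have base: "energy_moment \<theta> \<gamma> s h = energy_moment 0 \<gamma> s h" if "h > 0" for s h
    using \<theta> energy_moment_shift[OF assms(1) that] by auto
  \<comment> \<open>Enlarging \<open>R\<close> only strengthens the claim and makes the level
    \<open>Hbar R\<close> positive.\<close>
  have enlarge: "\<forall>R. \<exists>C. \<forall>q p. p0 \<le> q \<and> q \<le> R \<and> p0 \<le> p \<and> p \<le> R \<longrightarrow> P C q p"
    if large: "\<And>R. p0 < R \<Longrightarrow> \<exists>C. \<forall>q p. p0 \<le> q \<and> q \<le> R \<and> p0 \<le> p \<and> p \<le> R \<longrightarrow> P C q p"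
    for P :: "real \<Rightarrow> real \<Rightarrow> real \<Rightarrow> bool"
  proof
    fix R
    obtain C where "\<forall>q p. p0 \<le> q \<and> q \<le> max R (p0 + 1) \<and> p0 \<le> p \<and> p \<le> max R (p0 + 1) \<longrightarrow> P C q p"
      using large[of "max R (p0 + 1)"] by (auto simp: less_max_iff_disj)
    then show "\<exists>C. \<forall>q p. p0 \<le> q \<and> q \<le> R \<and> p0 \<le> p \<and> p \<le> R \<longrightarrow> P C q p"
      by (intro exI[of _ C]) (auto simp: le_max_iff_disj)
  qed
  \<comment> \<open>\<open>g\<close> decreases, so powers of \<open>g h / g r\<close> are at least
    one; inserting them turns plain bounds on \<open>I\<close> into bounds relative to powers of
    \<open>g\<close>.\<close>
  have le_gR: "x \<le> x / (g r)\<^sup>2 * (g h)\<^sup>2" "x \<le> x / (g r) ^ 3 * (g h) ^ 3"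
    if "0 \<le> x" "0 < h" "h \<le> r" for x h r
  proof -
    have "0 < g r" "g r \<le> g h" using that g_antimono[of h r] g_pos[of r] by auto
    then have "x * (g r) ^ n \<le> x * (g h) ^ n" for n using that(1) by (intro mult_left_mono power_mono) auto
    then show "x \<le> x / (g r)\<^sup>2 * (g h)\<^sup>2" "x \<le> x / (g r) ^ 3 * (g h) ^ 3"
      using \<open>0 < g r\<close> by (simp_all add: pos_le_divide_eq)
  qed
  have growth: "\<exists>C\<ge>0. \<forall>h>0. I h \<le> C * h powr (1/\<gamma> - 3/2)" if "\<gamma> > 2/3"
    using energy_moment_supercritical[OF that] base unfolding I_def by auto
  show ?thesis
  proof (intro conjI impI)
    assume \<gamma>: "2 < \<gamma>"
    show "\<forall>R. \<exists>C. \<forall>q p. p0 \<le> q \<and> q \<le> R \<and> p0 \<le> p \<and> p \<le> R \<longrightarrow>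
        \<bar>Hbar' q - Hbar' p\<bar> \<le> C * \<bar>q - p\<bar> powr (1/2 - 1/\<gamma>)"
    proof (rule enlarge)
      fix R assume R: "p0 < R"
      obtain C where C: "C \<ge> 0" "\<And>h. h > 0 \<Longrightarrow> I h \<le> C * h powr (1/\<gamma> - 3/2)"
        using growth \<gamma> by auto
      obtain c where c: "c > 0" "\<And>h. 0 < h \<Longrightarrow> h \<le> Hbar R \<Longrightarrow> c * h powr (1/\<gamma> - 1/2) \<le> g h"
        using energy_moment_lower[OF assms(1) Hbar_pos[OF R]] base unfolding g_def by auto
      show "\<exists>C. \<forall>q p. p0 \<le> q \<and> q \<le> R \<and> p0 \<le> p \<and> p \<le> R \<longrightarrow>
        \<bar>Hbar' q - Hbar' p\<bar> \<le> C * \<bar>q - p\<bar> powr (1/2 - 1/\<gamma>)"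
      \<comment> \<open>For \<open>\<alpha> = 1/2 - 1/\<gamma>\<close> the exponents satisfy
        \<open>\<alpha> - 1 + 2 * (1/\<gamma> - 1/2) = 1/\<gamma> - 3/2\<close>; the middle term
        comes from the blow-up of \<open>g\<close>.\<close>
      proof (rule Hbar'_holder_of_power[where K = "C / c\<^sup>2", OF _ _ R])
        fix h assume h: "0 < h" "h \<le> Hbar R"
        have "I h \<le> C * h powr (1/\<gamma> - 3/2)" by (rule C(2)[OF h(1)])
        also have "\<dots> = C / c\<^sup>2 * h powr (1/2 - 1/\<gamma> - 1) * (c * h powr (1/\<gamma> - 1/2))\<^sup>2"
        proof -
          have "(h powr (1/\<gamma> - 1/2))\<^sup>2 = h powr (2/\<gamma> - 1)"
            using h(1) by (simp add: powr_powr algebra_simps flip: powr_numeral)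
          then show ?thesis using c(1) by (simp add: power_mult_distrib flip: powr_add)
        qed
        also have "\<dots> \<le> C / c\<^sup>2 * h powr (1/2 - 1/\<gamma> - 1) * (g h)\<^sup>2"
          using c C(1) h by (intro mult_left_mono power_mono) auto
        finally show "I h \<le> C / c\<^sup>2 * h powr (1/2 - 1/\<gamma> - 1) * (g h)\<^sup>2" .
      qed (use \<gamma> C in \<open>auto simp: field_simps\<close>)
    qed
  next
    assume \<gamma>: "\<gamma> = 2"
    show "\<forall>R. \<exists>C. \<forall>q p. p0 < q \<and> q \<le> R \<and> p0 < p \<and> p \<le> R \<longrightarrow>
        \<bar>Hbar' q - Hbar' p\<bar> \<le> C * \<bar>ln (Hbar q) - ln (Hbar p)\<bar>"
    proof
      fix R
      show "\<exists>C. \<forall>q p. p0 < q \<and> q \<le> R \<and> p0 < p \<and> p \<le> R \<longrightarrow>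
        \<bar>Hbar' q - Hbar' p\<bar> \<le> C * \<bar>ln (Hbar q) - ln (Hbar p)\<bar>"
      proof (cases "p0 < R")
        case True
        obtain C where C: "C \<ge> 0" "\<And>h. h > 0 \<Longrightarrow> I h \<le> C * h powr (1/\<gamma> - 3/2)"
          using growth \<gamma> by auto
        show ?thesis
        proof (rule Hbar'_log[where K = "C / (g (Hbar R))\<^sup>2", OF True])
          fix h assume h: "0 < h" "h \<le> Hbar R"
          have "I h \<le> C * (1 / h)" using C(2)[OF h(1)] h(1) \<gamma> by (simp add: powr_minus_divide)
          also have "\<dots> \<le> C * (1 / h) / (g (Hbar R))\<^sup>2 * (g h)\<^sup>2"
            using C(1) h by (intro le_gR) auto
          finally show "I h \<le> C / (g (Hbar R))\<^sup>2 * (1 / h) * (g h)\<^sup>2" by (simp add: mult_ac)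
        qed (use C in simp)
      qed auto
    qed
  next
    assume \<gamma>: "2/3 < \<gamma> \<and> \<gamma> < 2"
    show "\<forall>R. \<exists>C. \<forall>q p. p0 \<le> q \<and> q \<le> R \<and> p0 \<le> p \<and> p \<le> R \<longrightarrow>
        \<bar>Hbar' q - Hbar' p\<bar> \<le> C * \<bar>q - p\<bar> powr (1/\<gamma> - 1/2)"
    proof (rule enlarge)
      fix R assume R: "p0 < R"
      obtain C where C: "C \<ge> 0" "\<And>h. h > 0 \<Longrightarrow> I h \<le> C * h powr (1/\<gamma> - 3/2)"
        using growth \<gamma> by auto
      show "\<exists>C. \<forall>q p. p0 \<le> q \<and> q \<le> R \<and> p0 \<le> p \<and> p \<le> R \<longrightarrow>
        \<bar>Hbar' q - Hbar' p\<bar> \<le> C * \<bar>q - p\<bar> powr (1/\<gamma> - 1/2)"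
      \<comment> \<open>Here the positive lower bound of \<open>g\<close> suffices, and
        \<open>1/\<gamma> - 3/2\<close> is already \<open>\<alpha> - 1\<close>.\<close>
      proof (rule Hbar'_holder_of_power[where K = "C / (g (Hbar R))\<^sup>2", OF _ _ R])
        fix h assume h: "0 < h" "h \<le> Hbar R"
        have "I h \<le> C * h powr (1/\<gamma> - 3/2)" by (rule C(2)[OF h(1)])
        also have "\<dots> \<le> C * h powr (1/\<gamma> - 3/2) / (g (Hbar R))\<^sup>2 * (g h)\<^sup>2"
          using C(1) h by (intro le_gR) auto
        finally show "I h \<le> C / (g (Hbar R))\<^sup>2 * h powr (1/\<gamma> - 1/2 - 1) * (g h)\<^sup>2" by simp
      qed (use \<gamma> C in \<open>auto simp: field_simps\<close>)
    qed
  next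
    assume \<gamma>: "\<gamma> = 2/3"
    obtain C where C: "C \<ge> 0" "\<And>h. 0 < h \<Longrightarrow> h \<le> 1 \<Longrightarrow> I h \<le> C * (1 + \<bar>ln h\<bar>)"
      using energy_moment_critical base unfolding I_def \<gamma> by auto
    \<comment> \<open>The first entry serves levels up to \<open>1\<close>, the second those
      above.\<close>
    define K where "K = max (C / (g 1)\<^sup>2) (1 + 4 powr \<gamma>)"
    have K: "C / (g 1)\<^sup>2 \<le> K" "1 + 4 powr \<gamma> \<le> K" by (simp_all add: K_def)
    have K0: "0 \<le> K" by (rule order_trans[OF _ K(2)]) simp
    show "\<forall>\<eta>>0. \<exists>C. \<forall>q p. p0 \<le> q \<and> p0 \<le> p \<and>
          Hbar q \<notin> {1 - \<eta><..<1} \<and> Hbar p \<notin> {1 - \<eta><..<1} \<longrightarrow>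
        \<bar>Hbar' q - Hbar' p\<bar>
          \<le> C * \<bar>Hbar q * (1 + \<bar>ln (Hbar q)\<bar>) - Hbar p * (1 + \<bar>ln (Hbar p)\<bar>)\<bar>"
    proof (intro allI impI, rule Hbar'_log_weight[OF _ K0])
      fix h :: real assume h: "0 < h" "h \<le> 1"
      have "I h \<le> C * (1 + \<bar>ln h\<bar>)" by (rule C(2)[OF h])
      also have "\<dots> \<le> C * (1 + \<bar>ln h\<bar>) / (g 1)\<^sup>2 * (g h)\<^sup>2"
        by (intro le_gR mult_nonneg_nonneg add_nonneg_nonneg abs_ge_zero zero_le_one C(1) h)
      also have "\<dots> = C / (g 1)\<^sup>2 * ((1 + \<bar>ln h\<bar>) * (g h)\<^sup>2)" by simp
      also have "\<dots> \<le> K * ((1 + \<bar>ln h\<bar>) * (g h)\<^sup>2)" by (intro mult_right_mono K) simp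
      finally show "I h \<le> K * (1 + \<bar>ln h\<bar>) * (g h)\<^sup>2" by (simp only: mult.assoc)
    next
      fix h :: real assume h: "1 \<le> h"
      have "I h \<le> (1 + 4 powr \<gamma>) * (g h)\<^sup>2"
        unfolding I_def g_def by (rule energy_moment_ratio_bounds(1)[OF assms(1) h])
      also have "\<dots> \<le> K * (g h)\<^sup>2" by (intro mult_right_mono K) simp
      finally show "I h \<le> K * (g h)\<^sup>2" .
    qed
  next
    assume \<gamma>: "\<gamma> < 2/3"
    obtain C where C: "C \<ge> 0" "\<And>h. 0 < h \<Longrightarrow> h \<le> 1 \<Longrightarrow> I h \<le> C"
      using energy_moment_subcritical[OF assms(1) \<gamma>] base unfolding I_def by auto
    define K where "K = max (C / (g 1) ^ 3) ((1 + 4 powr \<gamma>) powr (3/2))"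
    have K: "C / (g 1) ^ 3 \<le> K" "(1 + 4 powr \<gamma>) powr (3/2) \<le> K" by (simp_all add: K_def)
    show "\<exists>C. \<forall>q p. p0 \<le> q \<and> p0 \<le> p \<longrightarrow> \<bar>Hbar' q - Hbar' p\<bar> \<le> C * \<bar>q - p\<bar>"
    proof (rule Hbar'_lipschitz)
      fix h :: real assume h: "0 < h"
      then have g0: "0 \<le> (g h) ^ 3" using g_pos[of h] by simp
      show "I h \<le> K * (g h) ^ 3"
      proof (cases "h \<le> 1")
        case True
        have "I h \<le> C" by (rule C(2)[OF h True])
        also have "\<dots> \<le> C / (g 1) ^ 3 * (g h) ^ 3" by (rule le_gR[OF C(1) h True])
        also have "\<dots> \<le> K * (g h) ^ 3" by (intro mult_right_mono K g0)
        finally show ?thesis .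
      next
        case False
        then have "I h \<le> (1 + 4 powr \<gamma>) powr (3/2) * (g h) ^ 3"
          unfolding I_def g_def by (intro energy_moment_ratio_bounds(2)[OF assms(1)]) simp
        also have "\<dots> \<le> K * (g h) ^ 3" by (intro mult_right_mono K g0)
        finally show ?thesis .
      qed
    qed
  qed
qed

end
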